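(* For any compact set $\mathfrak D\subset D$, $$\lim_{h\downarrow0}\,[V(s,x,w)-V(s,x,w+h)]=0$$ uniformly in $\mathfrak D$; i.e. for every $\varepsilon>0$ there is $\delta>0$ such that $|V(s,x,w)-V(s,x,w+h)|<\varepsilon$ whenever $0<h<\delta$ and $(s,x,w),(s,x,w+h)\in\mathfrak D$.
   Context: Model. Fix $T>0$ and constants $p>0$ (premium rate), $c>0$ (discount factor). On a probability space $(\Omega,\mathscr F,\mathbb P)$, let $N=(N_t)_{t\ge0}$ be a renewal counting process with jump times $\sigma_n$ ($\sigma_0=0$) and i.i.d. waiting times $T_i=\sigma_i-\sigma_{i-1}$ with distribution function $F$ on $[0,\infty)$ and density $f$; put $\bar F=1-F$. Let $(U_i)_{i\ge1}$ (claim sizes) be i.i.d., independent of $N$, with distribution function $G$ on $[0,\infty)$. Standing assumption: $F$ and $G$ are continuous on $[0,\infty)$; there is a continuous bounded function $\lambda:[0,\infty)\to[0,\infty)$ with $\bar F(t)=\exp(-\int_0^t\lambda(u)du)$, $\lambda(t)=f(t)/\bar F(t)>0$ for $t\in[0,T]$; and there is $\Lambda>0$ with $\lambda(w)\le\Lambda$ for $w\in[0,T]$. Put $Q_t=\sum_{i=1}^{N_t}U_i$, $W_t=t-\sigma_{N_t}$, and let $(\mathscr F_t)$ be the $\mathbb P$-augmented filtration generated by $N,Q,W$. For $s\in[0,T]$, $w\in[0,s]$, let $\mathbb P_{sw}=\mathbb P[\,\cdot\,|W_s=w]$ (regular conditional probability) and $N^{s,w}_t=N_t-N_s$ for $t\in[s,T]$;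 under $\mathbb P_{sw}$ this is a delayed renewal process: the first claim after $s$ occurs at time $s+T_1^{s,w}$, where $\mathbb P_{sw}\{T_1^{s,w}>t\}=\exp(-\int_w^{w+t}\lambda(u)du)$, and later waiting times are independent with law $F$. Put $Q^{s,w}_t=\sum_{i=1}^{N^{s,w}_t}U_i$ and $W^{s,w}_t=w+W_t-W_s$. Strategies and value function. Given $(s,x,w)$ with $x\ge0$, a dividend strategy $\pi=(L_t)$ gives the cumulative dividends $L_t=L_t^\pi$ paid from time $s$ to time $t$ ($L_s=0$; $L_{t+}$ includes a lump sum paid at time $t$, also for $t=T$). The wealth is $X^\pi_t=x+p(t-s)-Q^{s,w}_t-L_t$ and the ruin time is $\tau^\pi=\inf\{t\ge s:X^\pi_t<0\}$ ($\inf\emptyset=\infty$). $\pi$ is admissible, $\pi\in U_{ad}^{x,w}[s,T]$, if $L$ is $(\mathscr F_t)_{t\ge s}$-predictable, nondecreasing, càglàd, and dividends cannot cause bankruptcy: $L_t\le L_{t+}\le x+p(t-s)-Q^{s,w}_t$ for every $t\in[s,T]$ with $t<\tau^\pi$, and no dividends are paid at or after ruin. With $\mathbb E_{sxw}$ the expectation under $\mathbb P_{sw}$ with $X_s=x$, and $\int_s^{b+}$ denoting the integral over $[s,b]$ (lump sums at $s$ and $b$ included), $$J(s,x,w;\pi)=\mathbb E_{sxw}\Big[\int_s^{(\tau^\pi\wedge T)+}e^{-c(t-s)}dL_t^\pi\Big],\qquad V(s,x,w)=\sup_{\pi\in U_{ad}^{x,w}[s,T]}J(s,x,w;\pi).$$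 The domain is $D=\{(s,x,w):0\le s\le T,\ x\ge0,\ 0\le w\le s\}$.
   Formalization: The filtration is augmented by the null sets of P_sw, not of P, and Q^{s,w} is read as Q_t-Q_s (claims after s, not U_1,U_2,... reused), since otherwise strategies foresee claims when w<s; P_sw is a version with future claims independent of the past for every w. *)

theory Defs
  imports "HOL-Probability.Probability"
begin

section \<open>The claim process\<close>

text \<open>
  Waiting times \<open>Y i\<close> and claim sizes \<open>U i\<close> are indexed by \<open>i \<ge> 1\<close>; their values at index 0 are
  never used.
\<close>

definition jump_time :: "(nat \<Rightarrow> 'a \<Rightarrow> real) \<Rightarrow> nat \<Rightarrow> 'a \<Rightarrow> real" where
  "jump_time Y n \<omega> = (\<Sum>i=1..n. Y i \<omega>)"

definition claim_count :: "(nat \<Rightarrow> 'a \<Rightarrow> real) \<Rightarrow> real \<Rightarrow> 'a \<Rightarrow> nat" where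
  "claim_count Y t \<omega> = card {n. 1 \<le> n \<and> jump_time Y n \<omega> \<le> t}"

definition total_claim :: "(nat \<Rightarrow> 'a \<Rightarrow> real) \<Rightarrow> (nat \<Rightarrow> 'a \<Rightarrow> real) \<Rightarrow> real \<Rightarrow> 'a \<Rightarrow> real" where
  "total_claim Y U t \<omega> = (\<Sum>i=1..claim_count Y t \<omega>. U i \<omega>)"

definition clock :: "(nat \<Rightarrow> 'a \<Rightarrow> real) \<Rightarrow> real \<Rightarrow> 'a \<Rightarrow> real" where
  "clock Y t \<omega> = t - jump_time Y (claim_count Y t \<omega>) \<omega>"

text \<open>The filtration generated by \<open>N\<close>, \<open>Q\<close>, \<open>W\<close>, without null sets.\<close>

definition claim_history ::
    "'a set \<Rightarrow> (nat \<Rightarrow> 'a \<Rightarrow> real) \<Rightarrow> (nat \<Rightarrow> 'a \<Rightarrow> real) \<Rightarrow> real \<Rightarrow> 'a measure" where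
  "claim_history \<Omega> Y U t = sigma \<Omega>
     (\<Union>r\<in>{0..t}. sets (vimage_algebra \<Omega> (claim_count Y r) (count_space UNIV))
                \<union> sets (vimage_algebra \<Omega> (total_claim Y U r) borel)
                \<union> sets (vimage_algebra \<Omega> (clock Y r) borel))"

text \<open>
  The data of the process restarted at time \<open>s\<close>: the waiting time from \<open>s\<close> to the first claim
  after \<open>s\<close>, the subsequent waiting times, and the claims after \<open>s\<close> (indices \<open>k \<ge> 1\<close>).
\<close>

definition post_wait :: "(nat \<Rightarrow> 'a \<Rightarrow> real) \<Rightarrow> real \<Rightarrow> nat \<Rightarrow> 'a \<Rightarrow> real" where
  "post_wait Y s k \<omega> =
     (if k = 1 then jump_time Y (claim_count Y s \<omega> + 1) \<omega> - s else Y (claim_count Y s \<omega> + k) \<omega>)"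

definition post_claim ::
    "(nat \<Rightarrow> 'a \<Rightarrow> real) \<Rightarrow> (nat \<Rightarrow> 'a \<Rightarrow> real) \<Rightarrow> real \<Rightarrow> nat \<Rightarrow> 'a \<Rightarrow> real" where
  "post_claim Y U s k \<omega> = U (claim_count Y s \<omega> + k) \<omega>"

text \<open>Total claims in \<open>(s, t]\<close>, that is, the claims after \<open>s\<close> are numbered afresh.\<close>

definition post_total_claim ::
    "(nat \<Rightarrow> 'a \<Rightarrow> real) \<Rightarrow> (nat \<Rightarrow> 'a \<Rightarrow> real) \<Rightarrow> real \<Rightarrow> real \<Rightarrow> 'a \<Rightarrow> real" where
  "post_total_claim Y U s t \<omega> =
     (\<Sum>i=1..claim_count Y t \<omega> - claim_count Y s \<omega>. post_claim Y U s i \<omega>)"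

section \<open>The Sparre Andersen model\<close>

locale sparre_andersen = prob_space M
  for M :: "'a measure" +
  fixes T p c :: real
    and F f lam G :: "real \<Rightarrow> real"
    and Y U :: "nat \<Rightarrow> 'a \<Rightarrow> real"
  assumes pos: "T > 0" "p > 0" "c > 0"
    and Y_random: "\<And>i. i \<ge> 1 \<Longrightarrow> Y i \<in> borel_measurable M"
    and Y_nonneg: "\<And>i \<omega>. i \<ge> 1 \<Longrightarrow> \<omega> \<in> space M \<Longrightarrow> 0 \<le> Y i \<omega>"
    \<comment> \<open>\<open>N\<close> is a counting process: it is finite at all times.\<close>
    and N_finite: "\<And>t \<omega>. \<omega> \<in> space M \<Longrightarrow> finite {n. 1 \<le> n \<and> jump_time Y n \<omega> \<le> t}"
    and Y_indep: "indep_vars (\<lambda>_. borel) Y {1..}"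
    and Y_cdf: "\<And>i. i \<ge> 1 \<Longrightarrow> cdf (distr M borel (Y i)) = F"
    and Y_density: "\<And>i. i \<ge> 1 \<Longrightarrow> distributed M lborel (Y i) (\<lambda>t. ennreal (f t))"
    and f_nonneg: "\<And>t. 0 \<le> f t"
    and U_random: "\<And>i. i \<ge> 1 \<Longrightarrow> U i \<in> borel_measurable M"
    and U_indep: "indep_vars (\<lambda>_. borel) U {1..}"
    and U_cdf: "\<And>i. i \<ge> 1 \<Longrightarrow> cdf (distr M borel (U i)) = G"
    and G_supp: "\<And>x. x < 0 \<Longrightarrow> G x = 0"
    and YU_indep: "indep_var (PiM {1..} (\<lambda>_. borel)) (\<lambda>\<omega>. \<lambda>i\<in>{1..}. Y i \<omega>)
                             (PiM {1..} (\<lambda>_. borel)) (\<lambda>\<omega>. \<lambda>i\<in>{1..}. U i \<omega>)"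
    and F_cont: "continuous_on {0..} F"
    and G_cont: "continuous_on {0..} G"
    and lam_cont: "continuous_on {0..} lam"
    and lam_bounded: "bounded (lam ` {0..})"
    and lam_nonneg: "\<And>t. t \<ge> 0 \<Longrightarrow> 0 \<le> lam t"
    and F_lam: "\<And>t. t \<ge> 0 \<Longrightarrow> 1 - F t = exp (- integral {0..t} lam)"
    and lam_hazard: "\<And>t. t \<in> {0..T} \<Longrightarrow> lam t = f t / (1 - F t)"
    and lam_pos: "\<And>t. t \<in> {0..T} \<Longrightarrow> 0 < lam t"
    and lam_le: "\<exists>\<Lambda>>0. \<forall>w\<in>{0..T}. lam w \<le> \<Lambda>"

text \<open>
  \<open>K s w\<close> is \<open>P[ \<sqdot> | W\<^sub>s = w]\<close>.  Being a regular conditional probability determines \<open>K s w\<close> only for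
  almost every \<open>w\<close>; the remaining assumptions select the version under which, for \<^emph>\<open>every\<close>
  \<open>w \<in> [0, s]\<close>, the process restarted at \<open>s\<close> is a delayed renewal risk process independent of the
  history up to \<open>s\<close>.
\<close>

locale conditioned_sparre_andersen = sparre_andersen M T p c F f lam G Y U
  for M :: "'a measure"
    and T p c :: real
    and F f lam G :: "real \<Rightarrow> real"
    and Y U :: "nat \<Rightarrow> 'a \<Rightarrow> real" +
  fixes K :: "real \<Rightarrow> real \<Rightarrow> 'a measure"
  assumes K_kernel:
      "\<And>s. s \<in> {0..T} \<Longrightarrow> K s \<in> restrict_space borel {0..s} \<rightarrow>\<^sub>M prob_algebra M"
    and K_cond: "\<And>s A B. s \<in> {0..T} \<Longrightarrow> A \<in> sets M \<Longrightarrow> B \<in> sets borel \<Longrightarrow>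
      emeasure M (A \<inter> clock Y s -` B) =
        (\<integral>\<^sup>+ w \<in> B \<inter> {0..s}. emeasure (K s w) A \<partial>distr M borel (clock Y s))"
    and K_clock: "\<And>s w. s \<in> {0..T} \<Longrightarrow> w \<in> {0..s} \<Longrightarrow> AE \<omega> in K s w. clock Y s \<omega> = w"
    and K_first: "\<And>s w t. s \<in> {0..T} \<Longrightarrow> w \<in> {0..s} \<Longrightarrow> t \<ge> 0 \<Longrightarrow>
      measure (K s w) {\<omega> \<in> space M. post_wait Y s 1 \<omega> > t} = exp (- integral {w..w+t} lam)"
    and K_later: "\<And>s w k. s \<in> {0..T} \<Longrightarrow> w \<in> {0..s} \<Longrightarrow> k \<ge> 2 \<Longrightarrow>
      cdf (distr (K s w) borel (post_wait Y s k)) = F"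
    and K_claim: "\<And>s w k. s \<in> {0..T} \<Longrightarrow> w \<in> {0..s} \<Longrightarrow> k \<ge> 1 \<Longrightarrow>
      cdf (distr (K s w) borel (post_claim Y U s k)) = G"
    and K_wait_indep: "\<And>s w. s \<in> {0..T} \<Longrightarrow> w \<in> {0..s} \<Longrightarrow>
      prob_space.indep_vars (K s w) (\<lambda>_. borel) (post_wait Y s) {1..}"
    and K_claim_indep: "\<And>s w. s \<in> {0..T} \<Longrightarrow> w \<in> {0..s} \<Longrightarrow>
      prob_space.indep_vars (K s w) (\<lambda>_. borel) (post_claim Y U s) {1..}"
    and K_wait_claim_indep: "\<And>s w. s \<in> {0..T} \<Longrightarrow> w \<in> {0..s} \<Longrightarrow>
      prob_space.indep_var (K s w)
        (PiM {1..} (\<lambda>_. borel)) (\<lambda>\<omega>. \<lambda>k\<in>{1..}. post_wait Y s k \<omega>)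
        (PiM {1..} (\<lambda>_. borel)) (\<lambda>\<omega>. \<lambda>k\<in>{1..}. post_claim Y U s k \<omega>)"
    and K_history_indep: "\<And>s w. s \<in> {0..T} \<Longrightarrow> w \<in> {0..s} \<Longrightarrow>
      prob_space.indep_set (K s w) (sets (claim_history (space M) Y U s))
        (sets (vimage_algebra (space M)
          (\<lambda>\<omega>. (\<lambda>k\<in>{1..}. post_wait Y s k \<omega>, \<lambda>k\<in>{1..}. post_claim Y U s k \<omega>))
          (PiM {1..} (\<lambda>_. borel) \<Otimes>\<^sub>M PiM {1..} (\<lambda>_. borel))))"

section \<open>Dividend strategies and the value function\<close>

text \<open>
  For the problem started from \<open>(s, w)\<close> the measure is \<open>P = K s w\<close>, and the filtration is augmented
  by the null sets of this \<open>P\<close>.  (With the null sets of the unconditional measure the strategies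
  would be clairvoyant: for \<open>w < s\<close> the event \<open>W\<^sub>s = w\<close> has unconditional probability 0, so all its
  subsets would be known at time 0.)
\<close>

definition aug_history ::
    "'a measure \<Rightarrow> (nat \<Rightarrow> 'a \<Rightarrow> real) \<Rightarrow> (nat \<Rightarrow> 'a \<Rightarrow> real) \<Rightarrow> real \<Rightarrow> 'a measure" where
  "aug_history P Y U t =
     sigma (space P) (sets (claim_history (space P) Y U t) \<union> null_sets (completion P))"

definition predictable_algebra :: "'a set \<Rightarrow> real \<Rightarrow> (real \<Rightarrow> 'a measure) \<Rightarrow> (real \<times> 'a) measure" where
  "predictable_algebra \<Omega> s \<F> = sigma ({s..} \<times> \<Omega>)
     ({{s} \<times> A | A. A \<in> sets (\<F> s)} \<union> {{u<..v} \<times> A | u v A. s \<le> u \<and> u < v \<and> A \<in> sets (\<F> u)})"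

definition caglad_from :: "real \<Rightarrow> (real \<Rightarrow> real) \<Rightarrow> bool" where
  "caglad_from s g \<longleftrightarrow>
     (\<forall>t>s. (g \<longlongrightarrow> g t) (at_left t)) \<and> (\<forall>t\<ge>s. \<exists>l. (g \<longlongrightarrow> l) (at_right t))"

definition right_lim :: "(real \<Rightarrow> 'a \<Rightarrow> real) \<Rightarrow> real \<Rightarrow> 'a \<Rightarrow> real" where
  "right_lim L t \<omega> = Lim (at_right t) (\<lambda>r. L r \<omega>)"

definition wealth :: "real \<Rightarrow> (nat \<Rightarrow> 'a \<Rightarrow> real) \<Rightarrow> (nat \<Rightarrow> 'a \<Rightarrow> real) \<Rightarrow> real \<Rightarrow> real
    \<Rightarrow> (real \<Rightarrow> 'a \<Rightarrow> real) \<Rightarrow> real \<Rightarrow> 'a \<Rightarrow> real" where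
  "wealth p Y U s x L t \<omega> = x + p * (t - s) - post_total_claim Y U s t \<omega> - L t \<omega>"

definition ruin_time :: "real \<Rightarrow> (nat \<Rightarrow> 'a \<Rightarrow> real) \<Rightarrow> (nat \<Rightarrow> 'a \<Rightarrow> real) \<Rightarrow> real \<Rightarrow> real
    \<Rightarrow> (real \<Rightarrow> 'a \<Rightarrow> real) \<Rightarrow> 'a \<Rightarrow> ereal" where
  "ruin_time p Y U s x L \<omega> = Inf (ereal ` {t. s \<le> t \<and> wealth p Y U s x L t \<omega> < 0})"

text \<open>
  Strategies are processes on \<open>[s, \<infinity>)\<close>, so that the terminal lump sum is \<open>L\<^sub>T\<^sub>+ - L\<^sub>T\<close>; their values
  after \<open>T\<close> play no other role.
\<close>

definition admissible :: "'a measure \<Rightarrow> real \<Rightarrow> real \<Rightarrow> (nat \<Rightarrow> 'a \<Rightarrow> real) \<Rightarrow> (nat \<Rightarrow> 'a \<Rightarrow> real)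
    \<Rightarrow> real \<Rightarrow> real \<Rightarrow> (real \<Rightarrow> 'a \<Rightarrow> real) set" where
  "admissible P T p Y U s x = {L.
     case_prod L \<in> borel_measurable (predictable_algebra (space P) s (aug_history P Y U)) \<and>
     (AE \<omega> in P.
        L s \<omega> = 0 \<and> mono_on {s..} (\<lambda>t. L t \<omega>) \<and> caglad_from s (\<lambda>t. L t \<omega>) \<and>
        (\<forall>t\<in>{s..T}. ereal t < ruin_time p Y U s x L \<omega> \<longrightarrow>
           L t \<omega> \<le> right_lim L t \<omega> \<and>
           right_lim L t \<omega> \<le> x + p * (t - s) - post_total_claim Y U s t \<omega>) \<and>
        (\<forall>t\<in>{s..T}. ruin_time p Y U s x L \<omega> \<le> ereal t \<longrightarrow>
           right_lim L t \<omega> = L (real_of_ereal (ruin_time p Y U s x L \<omega>)) \<omega>))}"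

text \<open>
  The measure \<open>dL\<close> on \<open>[s, \<infinity>)\<close>, with distribution function \<open>t \<mapsto> L\<^sub>t\<^sub>+\<close>; it has an atom at \<open>s\<close> when
  a lump sum is paid at \<open>s\<close>.
\<close>

definition dividend_measure :: "real \<Rightarrow> (real \<Rightarrow> 'a \<Rightarrow> real) \<Rightarrow> 'a \<Rightarrow> real measure" where
  "dividend_measure s L \<omega> = interval_measure (\<lambda>t. if t < s then 0 else right_lim L t \<omega>)"

definition J_fun :: "'a measure \<Rightarrow> real \<Rightarrow> real \<Rightarrow> real \<Rightarrow> (nat \<Rightarrow> 'a \<Rightarrow> real) \<Rightarrow> (nat \<Rightarrow> 'a \<Rightarrow> real)
    \<Rightarrow> real \<Rightarrow> real \<Rightarrow> (real \<Rightarrow> 'a \<Rightarrow> real) \<Rightarrow> ennreal" where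
  "J_fun P T p c Y U s x L =
     (\<integral>\<^sup>+\<omega>. (\<integral>\<^sup>+t\<in>{s..real_of_ereal (min (ruin_time p Y U s x L \<omega>) (ereal T))}.
              ennreal (exp (- c * (t - s))) \<partial>dividend_measure s L \<omega>) \<partial>completion P)"

text \<open>Extended real values, so that an infinite value could not be mistaken for a finite one.\<close>

definition value_fun :: "(real \<Rightarrow> real \<Rightarrow> 'a measure) \<Rightarrow> real \<Rightarrow> real \<Rightarrow> real
    \<Rightarrow> (nat \<Rightarrow> 'a \<Rightarrow> real) \<Rightarrow> (nat \<Rightarrow> 'a \<Rightarrow> real) \<Rightarrow> real \<Rightarrow> real \<Rightarrow> real \<Rightarrow> ereal" where
  "value_fun K T p c Y U s x w =
     (SUP L\<in>admissible (K s w) T p Y U s x. enn2ereal (J_fun (K s w) T p c Y U s x L))"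

definition state_domain :: "real \<Rightarrow> (real \<times> real \<times> real) set" where
  "state_domain T = {(s, x, w). 0 \<le> s \<and> s \<le> T \<and> 0 \<le> x \<and> 0 \<le> w \<and> w \<le> s}"

end

theory Submission
  imports Defs
begin

text \<open>
  Given the clock reading \<open>w\<close> at time \<open>s\<close>, the claims after \<open>s\<close> form a delayed renewal process in
  which only the first waiting time depends on \<open>w\<close>; its density is
  \<open>t \<mapsto> lam (w + t) * exp (- integral {w..w+t} lam)\<close>.  This density depends on \<open>w\<close> continuously in
  \<open>L\<^sup>1\<close>, uniformly for \<open>w \<in> [0, T]\<close> (\<open>wait_excess_small\<close>).  Discounted dividends never exceed
  \<open>x + p * T\<close>.  So if one and the same strategy could be used under \<open>K s w\<close> and under \<open>K s w'\<close>, its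
  two values would differ by at most \<open>x + p * T\<close> times the \<open>L\<^sup>1\<close> distance of the two densities, and
  the theorem would follow by taking suprema in both directions.

  Two things prevent a strategy from being moved from \<open>w\<close> to \<open>w'\<close>.  It may depend on the claims
  before \<open>s\<close>, and the laws of that past under the two measures are mutually singular, as they
  give the clock at \<open>s\<close> different values.  And its properties hold only almost surely under
  \<open>K s w\<close>, with a filtration completed by the null sets of \<open>K s w\<close>.

  The past is removed by randomisation.  Events up to \<open>r \<ge> s\<close> are sections along the diagonal of
  events in (past up to \<open>s\<close>) times (future between \<open>s\<close> and \<open>r\<close>), by \<open>history_split\<close>.  Past and
  future are independent under \<open>K s w\<close>, so the value of a strategy is the average, over a frozen
  past \<open>\<omega>\<^sub>1\<close>, of the values of strategies that look at the future only (\<open>J_eq_average_level_worth\<close>).  Each of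
  these is available under \<open>K s w'\<close> too.

  The null sets are removed by rebuilding paths from countably many data.  A nondecreasing
  left-continuous path is determined by the truth values of \<open>l r > q\<close> for rational \<open>r\<close> and \<open>q\<close>.
  Conversely, any family of truth values, however inconsistent, yields such a path, which becomes
  admissible if it is stopped at the first time at which it exceeds the reserve
  (\<open>halted_admissible\<close>).  If the truth values do come from an admissible path, then rebuilding and
  stopping changes no payment up to \<open>T\<close> (\<open>halted_right_limit\<close>).  Hence the events \<open>{L\<^sub>r > q}\<close> may
  be altered on null sets, and the rebuilt strategy is admissible everywhere, under every measure.
\<close>

section \<open>Dividend paths rebuilt from their rational levels\<close>

text \<open>
  The smallest nonnegative path that is at least \<open>q\<close> after time \<open>r\<close> for all rational \<open>r > s\<close> and
  \<open>q \<in> [0, C]\<close> with \<open>a r q\<close>; it is nondecreasing and left-continuous.  The ceiling \<open>C\<close> keeps the supremum finite for arbitrary \<open>a\<close>, and the element 0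
  gives the value before the first accepted level.
\<close>
definition staircase :: "real \<Rightarrow> real \<Rightarrow> (real \<Rightarrow> real \<Rightarrow> bool) \<Rightarrow> real \<Rightarrow> real" where
  "staircase s C a t = Sup (insert 0 {q \<in> \<rat>. 0 \<le> q \<and> q \<le> C \<and> (\<exists>r\<in>\<rat>. s < r \<and> r < t \<and> a r q)})"

lemma staircase_bdd: "bdd_above (insert 0 {q \<in> \<rat>. 0 \<le> q \<and> q \<le> C \<and> (\<exists>r\<in>\<rat>. s < r \<and> r < t \<and> a r q)})"
  for C :: real
  by (rule bdd_aboveI[of _ "max 0 C"]) auto

lemma less_staircase_iff:
  "y < staircase s C a t \<longleftrightarrow>
     y < 0 \<or> (\<exists>q\<in>\<rat>. \<exists>r\<in>\<rat>. y < q \<and> 0 \<le> q \<and> q \<le> C \<and> s < r \<and> r < t \<and> a r q)"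
  unfolding staircase_def by (subst less_cSup_iff[OF _ staircase_bdd]) auto

lemma staircase_le_iff:
  "staircase s C a t \<le> y \<longleftrightarrow>
     0 \<le> y \<and> (\<forall>q\<in>\<rat>. \<forall>r\<in>\<rat>. 0 \<le> q \<longrightarrow> q \<le> C \<longrightarrow> s < r \<longrightarrow> r < t \<longrightarrow> a r q \<longrightarrow> q \<le> y)"
  using less_staircase_iff[of y s C a t] by (meson not_le)

lemma staircase_nonneg: "0 \<le> staircase s C a t"
  using less_staircase_iff[of _ s C a t] by (meson not_le order.strict_iff_not)

lemma staircase_le: "0 \<le> C \<Longrightarrow> staircase s C a t \<le> C"
  by (simp add: staircase_le_iff)

lemma staircase_start: "t \<le> s \<Longrightarrow> staircase s C a t = 0"
  by (rule antisym) (auto simp: staircase_nonneg staircase_le_iff)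

lemma staircase_mono: "t \<le> t' \<Longrightarrow> staircase s C a t \<le> staircase s C a t'"
proof -
  have "\<not> staircase s C a t' < staircase s C a t" if "t \<le> t'"
  proof
    let ?y = "staircase s C a t'"
    assume "?y < staircase s C a t"
    then obtain q r where "q \<in> \<rat>" "r \<in> \<rat>" "?y < q" "0 \<le> q" "q \<le> C" "s < r" "r < t" "a r q"
      unfolding less_staircase_iff[of ?y s C a t] using staircase_nonneg[of s C a t'] by auto
    then have "?y < ?y"
      using that less_staircase_iff[of ?y s C a t'] by (metis order_less_le_trans)
    then show False by simp
  qed
  then show "t \<le> t' \<Longrightarrow> staircase s C a t \<le> staircase s C a t'" by (simp add: not_less)
qed

lemma staircase_left: "(staircase s C a \<longlongrightarrow> staircase s C a t) (at_left t)"
proof (rule order_tendstoI)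
  fix y assume "y < staircase s C a t"
  then consider "y < 0" | r where "r < t" "\<And>u. r < u \<Longrightarrow> y < staircase s C a u"
    unfolding less_staircase_iff[of y s C a] by blast
  then show "\<forall>\<^sub>F u in at_left t. y < staircase s C a u"
  proof cases
    case 1
    then show ?thesis by (simp add: less_staircase_iff)
  next
    case 2
    then show ?thesis using eventually_at_left[of r t] by blast
  qed
next
  fix y assume "staircase s C a t < y"
  then have "staircase s C a u < y" if "u < t" for u
    using staircase_mono[of u t s C a] that by simp
  then show "\<forall>\<^sub>F u in at_left t. staircase s C a u < y"
    unfolding eventually_at_filter by (intro always_eventually) auto
qed

text \<open>
  The one-sided limit exists because \<open>l\<close> is monotone: it is the infimum of \<open>l\<close> over the points to
  the right of \<open>t\<close>.
\<close>
lemma mono_right_limit: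
  fixes l :: "real \<Rightarrow> real"
  assumes m: "mono_on {s..} l" and "s \<le> t"
  shows "(l \<longlongrightarrow> Lim (at_right t) l) (at_right t)"
    and "\<And>u. t < u \<Longrightarrow> Lim (at_right t) l \<le> l u"
    and "l t \<le> Lim (at_right t) l"
proof -
  let ?i = "Inf (l ` {t<..})"
  have bdd: "bdd_below (l ` {t<..})"
    by (rule bdd_belowI[of _ "l t"]) (use assms in \<open>auto intro: mono_onD[OF m]\<close>)
  have lim: "(l \<longlongrightarrow> ?i) (at_right t)"
  proof (rule order_tendstoI)
    fix y assume y: "y < ?i"
    have "y < l u" if "t < u" for u
      using y cINF_lower[OF bdd, of u] that by simp
    then show "\<forall>\<^sub>F u in at_right t. y < l u"
      by (auto simp: eventually_at_right_less eventually_at_filter)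
  next
    fix y assume "?i < y"
    then obtain u where u: "t < u" "l u < y"
      using cINF_less_iff[OF _ bdd, of y] by auto
    have "l v < y" if "t < v" "v < u" for v
      using u that \<open>s \<le> t\<close> mono_onD[OF m, of v u] by auto
    then show "\<forall>\<^sub>F v in at_right t. l v < y"
      using eventually_at_right[of t u] u by blast
  qed
  have eq: "Lim (at_right t) l = ?i"
    by (rule tendsto_Lim[OF _ lim]) simp
  show "(l \<longlongrightarrow> Lim (at_right t) l) (at_right t)" using lim eq by simp
  show "\<And>u. t < u \<Longrightarrow> Lim (at_right t) l \<le> l u"
    using cINF_lower[OF bdd] eq by simp
  show "l t \<le> Lim (at_right t) l"
    unfolding eq by (rule cINF_greatest) (use assms in \<open>auto intro: mono_onD[OF m]\<close>)
qed

lemma staircase_mono_on: "mono_on S (staircase s C a)"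
  by (auto simp: mono_on_def staircase_mono)

lemma staircase_caglad: "caglad_from s (staircase s C a)"
  unfolding caglad_from_def
  using staircase_left mono_right_limit(1)[OF staircase_mono_on] by blast

text \<open>
  In this and the next definition \<open>R\<close> is the reserve path before dividends and \<open>l\<close> a dividend
  path: the conditions that the model imposes for almost every scenario, for a single scenario.
\<close>
definition ruin_at :: "real \<Rightarrow> (real \<Rightarrow> real) \<Rightarrow> (real \<Rightarrow> real) \<Rightarrow> ereal" where
  "ruin_at s R l = Inf (ereal ` {t. s \<le> t \<and> R t - l t < 0})"

definition admissible_path :: "real \<Rightarrow> real \<Rightarrow> (real \<Rightarrow> real) \<Rightarrow> (real \<Rightarrow> real) \<Rightarrow> bool" where
  "admissible_path s T R l \<longleftrightarrow>
     l s = 0 \<and> mono_on {s..} l \<and> caglad_from s l \<and>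
     (\<forall>t\<in>{s..T}. ereal t < ruin_at s R l \<longrightarrow>
        l t \<le> Lim (at_right t) l \<and> Lim (at_right t) l \<le> R t) \<and>
     (\<forall>t\<in>{s..T}. ruin_at s R l \<le> ereal t \<longrightarrow>
        Lim (at_right t) l = l (real_of_ereal (ruin_at s R l)))"

lemma solvent_before_ruin:
  assumes "s \<le> t" "ereal t < ruin_at s R l"
  shows "l t \<le> R t"
proof (rule ccontr)
  assume "\<not> l t \<le> R t"
  then have "ruin_at s R l \<le> ereal t"
    unfolding ruin_at_def using assms by (intro INF_lower) auto
  then show False using assms by simp
qed

lemma ruin_at_geI:
  assumes "\<And>u. s \<le> u \<Longrightarrow> u < t \<Longrightarrow> l u \<le> R u"
  shows "ereal t \<le> ruin_at s R l"
  unfolding ruin_at_def using assms by (intro INF_greatest) (force simp: not_less)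

lemma ruin_at_ge: "ereal s \<le> ruin_at s R l"
  by (rule ruin_at_geI) simp

lemma ruin_at_realE:
  assumes "ruin_at s R l \<le> ereal t"
  obtains u where "ruin_at s R l = ereal u" "s \<le> u" "u \<le> t"
  using assms ruin_at_ge[of s R l] by (cases "ruin_at s R l") auto

definition right_continuous_from :: "real \<Rightarrow> (real \<Rightarrow> real) \<Rightarrow> bool" where
  "right_continuous_from s R \<longleftrightarrow> (\<forall>t\<ge>s. (R \<longlongrightarrow> R t) (at_right t))"

text \<open>
  The levels of the path \<open>staircase s C a\<close> stopped at the first time at which it exceeds \<open>R\<close>.  The
  condition \<open>q < staircase s C a r\<close>, rather than \<open>a r q\<close>, refers to the path before \<open>r\<close> only: a
  lump sum paid at the stopping time itself is thereby suppressed, which might otherwise exceed the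
  reserve.  Only rational times need to be inspected, since the path is nondecreasing and \<open>R\<close> will
  be right-continuous, so that an excess at \<open>v\<close> persists immediately after \<open>v\<close>.
\<close>
definition halted :: "real \<Rightarrow> real \<Rightarrow> (real \<Rightarrow> real) \<Rightarrow> (real \<Rightarrow> real \<Rightarrow> bool) \<Rightarrow> real \<Rightarrow> real \<Rightarrow> bool" where
  "halted s C R a r q \<longleftrightarrow>
     q < staircase s C a r \<and> (\<forall>v\<in>\<rat>. s < v \<and> v < r \<longrightarrow> staircase s C a v \<le> R v)"

lemma rational_after:
  fixes t :: real
  assumes "\<forall>\<^sub>F u in at_right t. P u" "t < b"
  obtains v where "v \<in> \<rat>" "t < v" "v < b" "P v"
proof -
  obtain b' where b': "t < b'" "\<And>u. t < u \<Longrightarrow> u < b' \<Longrightarrow> P u"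
    using assms(1) unfolding eventually_at_right_field by blast
  obtain v where "v \<in> \<rat>" "t < v" "v < min b b'"
    using Rats_dense_in_real[of t "min b b'"] assms(2) b'(1) by auto
  with b' that show thesis by auto
qed

lemma halted_le: "staircase s C (halted s C R a) t \<le> staircase s C a t"
proof (rule leI, rule notI)
  assume "staircase s C a t < staircase s C (halted s C R a) t"
  then obtain q r where "staircase s C a t < q" "r < t" "q < staircase s C a r"
    using staircase_nonneg[of s C a t] unfolding less_staircase_iff[of "staircase s C a t" s C "halted s C R a" t] halted_def
    by auto
  then show False using staircase_mono[of r t s C a] by simp
qed

text \<open>
  While the path stays below \<open>R\<close>, stopping does not change it: left-continuity recovers the value
  at \<open>t\<close> from the levels strictly before \<open>t\<close>.
\<close>
lemma halted_eq:
  assumes "\<And>v. v \<in> \<rat> \<Longrightarrow> s < v \<Longrightarrow> v < b \<Longrightarrow> staircase s C a v \<le> R v" "t \<le> b"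
  shows "staircase s C (halted s C R a) t = staircase s C a t"
proof (rule antisym[OF halted_le leI], rule notI)
  assume less: "staircase s C (halted s C R a) t < staircase s C a t"
  define y where "y = staircase s C (halted s C R a) t"
  have y: "0 \<le> y" "y < staircase s C a t"
    using less by (auto simp: y_def staircase_nonneg)
  have "\<forall>\<^sub>F u in at_left t. y < staircase s C a u"
    using order_tendstoD(1)[OF staircase_left y(2)] .
  moreover have "s < t"
    using y staircase_start[of t s C a] by (cases "s < t") auto
  ultimately obtain t1 where t1: "t1 < t" "\<And>u. t1 < u \<Longrightarrow> u < t \<Longrightarrow> y < staircase s C a u"
    unfolding eventually_at_left_field by blast
  define t0 where "t0 = max s t1"
  have t0: "s \<le> t0" "t0 < t" "\<And>u. t0 < u \<Longrightarrow> u < t \<Longrightarrow> y < staircase s C a u"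
    using t1 \<open>s < t\<close> by (auto simp: t0_def)
  \<comment> \<open>Some level \<open>q > y\<close> is reached before a rational \<open>r < t\<close>; any smaller level \<open>q'\<close> is then accepted at \<open>r\<close>.\<close>
  obtain r where r: "r \<in> \<rat>" "t0 < r" "r < t" using Rats_dense_in_real[OF t0(2)] by auto
  then have "y < staircase s C a r" "s < r" using t0 by auto
  then obtain q r' where q: "q \<in> \<rat>" "y < q" "0 \<le> q" "q \<le> C" "r' < r" "a r' q" "s < r'" "r' \<in> \<rat>"
    using y(1) unfolding less_staircase_iff by auto
  obtain q' where q': "q' \<in> \<rat>" "y < q'" "q' < q" using Rats_dense_in_real[OF q(2)] by auto
  have "q' < staircase s C a r"
    using q q' unfolding less_staircase_iff by auto
  then have "halted s C R a r q'"
    unfolding halted_def using assms r by auto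
  moreover have "0 \<le> q'" "q' \<le> C" using q q' y(1) by simp_all
  ultimately have "y < staircase s C (halted s C R a) t"
    using q'(1,2) r(1,3) \<open>s < r\<close> unfolding less_staircase_iff[of y] by blast
  then have "y < y" by (simp add: y_def)
  then show False by simp
qed

text \<open>
  The hypothesis says that the stopping time is at most \<open>t\<close>.  Nothing is accepted at any \<open>r > t\<close>.
  What is accepted at \<open>r = t\<close> lies below the value of the unstopped path at \<open>t\<close>, so it adds nothing
  either.
\<close>
lemma halted_frozen:
  assumes "\<And>t'. t < t' \<Longrightarrow> \<exists>v\<in>\<rat>. s < v \<and> v < t' \<and> R v < staircase s C a v" "t \<le> u"
  shows "staircase s C (halted s C R a) u = staircase s C (halted s C R a) t"
proof (rule antisym[OF _ staircase_mono[OF assms(2)]])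
  have acc: "r \<le> t" if "halted s C R a r q" for r q
    using assms(1)[of r] that unfolding halted_def by (meson leD not_le)
  show "staircase s C (halted s C R a) u \<le> staircase s C (halted s C R a) t"
  \<comment> \<open>The case distinction is whether the path was stopped strictly before \<open>t\<close> or exactly at \<open>t\<close>.\<close>
  proof (cases "\<exists>v\<in>\<rat>. s < v \<and> v < t \<and> R v < staircase s C a v")
    case True
    then obtain v where v: "v \<in> \<rat>" "s < v" "v < t" "R v < staircase s C a v" by blast
    have early: "r < t" if "halted s C R a r q" for r q
      using that v unfolding halted_def by (meson le_less_trans not_le)
    have "q \<le> staircase s C (halted s C R a) t"
      if "q \<in> \<rat>" "0 \<le> q" "q \<le> C" "r \<in> \<rat>" "s < r" "halted s C R a r q" for q r
    proof (rule leI, rule notI)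
      assume less: "staircase s C (halted s C R a) t < q"
      have "staircase s C (halted s C R a) t < staircase s C (halted s C R a) t"
        unfolding less_staircase_iff[of "staircase s C (halted s C R a) t" s C "halted s C R a" t]
        using less that early[OF that(6)] by blast
      then show False by simp
    qed
    then show ?thesis
      unfolding staircase_le_iff[of s C "halted s C R a" u] by (auto simp: staircase_nonneg)
  next
    case False
    then have eq: "staircase s C (halted s C R a) t = staircase s C a t"
      by (intro halted_eq[of s t]) (auto simp: not_less)
    have "q \<le> staircase s C a t" if "halted s C R a r q" for q r
      using acc[OF that] staircase_mono[of r t s C a] that by (simp add: halted_def)
    then show ?thesis
      unfolding eq staircase_le_iff[of s C "halted s C R a"] by (auto simp: staircase_nonneg)
  qed
qed

lemma Lim_at_right_const:
  fixes l :: "real \<Rightarrow> real"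
  assumes "\<And>u. t < u \<Longrightarrow> l u = y"
  shows "Lim (at_right t) l = y"
proof (rule tendsto_Lim)
  show "(l \<longlongrightarrow> y) (at_right t)"
    by (rule tendsto_eventually) (use assms in \<open>auto simp: eventually_at_filter\<close>)
qed simp

text \<open>
  At every time \<open>t\<close> the stopped path either is frozen from \<open>t\<close> on, or stays below the reserve up to
  some time after \<open>t\<close>.  In the first case there is no payment at \<open>t\<close> or later; in the second there
  has been no ruin yet and the payment at \<open>t\<close> is covered.  This requires nothing of the family \<open>a\<close>.
\<close>
lemma halted_admissible:
  assumes R: "right_continuous_from s R"
  shows "admissible_path s T R (staircase s C (halted s C R a))"
proof -
  let ?L = "staircase s C a" and ?H = "staircase s C (halted s C R a)"
  note m = staircase_mono_on[of "{s..}" s C "halted s C R a"]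
  have dich: "(\<forall>u\<ge>t. ?H u = ?H t) \<or>
      (\<exists>b>t. (\<forall>u\<ge>s. u < b \<longrightarrow> ?H u \<le> R u) \<and> Lim (at_right t) ?H \<le> R t)" if "s \<le> t" for t
  proof (cases "\<forall>t'>t. \<exists>v\<in>\<rat>. s < v \<and> v < t' \<and> R v < ?L v")
    case True
    then show ?thesis using halted_frozen[of t s R C a] by blast
  next
    case False
    then obtain b where "t < b" "\<not> (\<exists>v\<in>\<rat>. s < v \<and> v < b \<and> R v < ?L v)" by blast
    then have b: "t < b" "\<And>v. v \<in> \<rat> \<Longrightarrow> s < v \<Longrightarrow> v < b \<Longrightarrow> ?L v \<le> R v"
      by (meson not_le)+
    have H: "?H v \<le> R v" if "v \<in> \<rat>" "s < v" "v < b" for v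
      using b(2)[OF that] halted_le[of s C R a v] by simp
    \<comment> \<open>A lower bound of the path to the right of \<open>u\<close> lies below \<open>R u\<close>, by testing at rational times
      that decrease to \<open>u\<close> and right-continuity of \<open>R\<close>.\<close>
    have *: "y \<le> R u" if "s \<le> u" "u < b" "\<And>v. u < v \<Longrightarrow> y \<le> ?H v" for u y
    proof (rule leI, rule notI)
      assume "R u < y"
      then have "\<forall>\<^sub>F v in at_right u. R v < y"
        using R that(1) unfolding right_continuous_from_def by (blast intro: order_tendstoD)
      from rational_after[OF this \<open>u < b\<close>] obtain v where "v \<in> \<rat>" "u < v" "v < b" "R v < y" .
      then show False using H[of v] that(1) that(3)[of v] by simp
    qed
    have "?H u \<le> R u" if "s \<le> u" "u < b" for u
      by (rule *[OF that]) (simp add: staircase_mono)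
    moreover have "Lim (at_right t) ?H \<le> R t"
      by (rule *[OF \<open>s \<le> t\<close> b(1)]) (rule mono_right_limit(2)[OF m \<open>s \<le> t\<close>])
    ultimately show ?thesis using b(1) by blast
  qed
  show ?thesis
    unfolding admissible_path_def
  proof (intro conjI ballI impI)
    show "?H s = 0" by (simp add: staircase_start)
    show "mono_on {s..} ?H" by (rule m)
    show "caglad_from s ?H" by (rule staircase_caglad)
  next
    fix t assume t: "t \<in> {s..T}" "ereal t < ruin_at s R ?H"
    show "?H t \<le> Lim (at_right t) ?H" using mono_right_limit(3)[OF m] t by simp
    have "s \<le> t" using t by simp
    from dich[OF this] show "Lim (at_right t) ?H \<le> R t"
    proof (elim disjE)
      assume "\<forall>u\<ge>t. ?H u = ?H t"
      then have "Lim (at_right t) ?H = ?H t" by (intro Lim_at_right_const) (blast intro: less_imp_le)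
      then show ?thesis using solvent_before_ruin[OF _ t(2)] t(1) by simp
    qed (use t in auto)
  next
    fix t assume t: "t \<in> {s..T}" "ruin_at s R ?H \<le> ereal t"
    obtain u where u: "ruin_at s R ?H = ereal u" "s \<le> u" "u \<le> t" using t(2) by (rule ruin_at_realE)
    from dich[OF u(2)] show "Lim (at_right t) ?H = ?H (real_of_ereal (ruin_at s R ?H))"
    proof (elim disjE)
      assume "\<forall>v\<ge>u. ?H v = ?H u"
      then have "Lim (at_right t) ?H = ?H u"
        using u(3) by (intro Lim_at_right_const) (meson le_less_trans less_imp_le)
      then show ?thesis using u by simp
    next
      assume "\<exists>b>u. (\<forall>v\<ge>s. v < b \<longrightarrow> ?H v \<le> R v) \<and> Lim (at_right u) ?H \<le> R u"
      then obtain b where "u < b" "\<And>v. s \<le> v \<Longrightarrow> v < b \<Longrightarrow> ?H v \<le> R v" by blast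
      then have "ereal b \<le> ereal u" using ruin_at_geI[of s b ?H R] u by auto
      with \<open>u < b\<close> show ?thesis by simp
    qed
  qed
qed

lemma staircase_of_path:
  assumes m: "mono_on {s..} l" and l0: "l s = 0" and cl: "caglad_from s l" and "0 \<le> C"
    and a: "\<And>r q. r \<in> \<rat> \<Longrightarrow> q \<in> \<rat> \<Longrightarrow> s < r \<Longrightarrow> a r q \<longleftrightarrow> q < l r"
    and t: "s \<le> t"
  shows "staircase s C a t = min (l t) C"
proof (rule antisym)
  have "0 \<le> l t" using mono_onD[OF m, of s t] l0 t by simp
  moreover have "q \<le> l t" if "q \<in> \<rat>" "r \<in> \<rat>" "s < r" "r < t" "a r q" for q r
    using a[of r q] mono_onD[OF m, of r t] that by auto
  ultimately show "staircase s C a t \<le> min (l t) C"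
    using \<open>0 \<le> C\<close> by (auto simp: staircase_le_iff)
  show "min (l t) C \<le> staircase s C a t"
  proof (rule leI, rule notI)
    let ?y = "staircase s C a t"
    assume less: "?y < min (l t) C"
    have y0: "0 \<le> ?y" by (rule staircase_nonneg)
    then have "s < t" using less l0 t by (cases "s = t") auto
    obtain q where q: "q \<in> \<rat>" "?y < q" "q < min (l t) C" using Rats_dense_in_real[OF less] by auto
    have "(l \<longlongrightarrow> l t) (at_left t)" using cl \<open>s < t\<close> unfolding caglad_from_def by blast
    then have "\<forall>\<^sub>F u in at_left t. q < l u" by (rule order_tendstoD) (use q in simp)
    then obtain t0 where t0: "t0 < t" "\<And>u. t0 < u \<Longrightarrow> u < t \<Longrightarrow> q < l u"
      unfolding eventually_at_left_field by blast
    obtain r where r: "r \<in> \<rat>" "max s t0 < r" "r < t"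
      using Rats_dense_in_real[of "max s t0" t] t0 \<open>s < t\<close> by auto
    have "a r q" using a[of r q] r q t0 by auto
    then have "?y < ?y"
      using q r unfolding less_staircase_iff[of ?y s C a t] by (intro disjI2 bexI[of _ q] bexI[of _ r]) (use y0 in auto)
    then show False by simp
  qed
qed

text \<open>
  Before ruin the path \<open>l\<close> stays below \<open>R\<close>, hence below \<open>C\<close>, so neither stopping nor the ceiling has
  any effect.  After ruin \<open>l\<close> is constant, so that stopping at ruin loses no payment.  Right limits
  are compared, because they include the lump sums and determine the dividend measure.
\<close>
lemma halted_right_limit:
  assumes adm: "admissible_path s T R l" and "0 \<le> C"
    and RC: "\<And>t. s \<le> t \<Longrightarrow> t \<le> T \<Longrightarrow> R t \<le> C"
    and a: "\<And>r q. r \<in> \<rat> \<Longrightarrow> q \<in> \<rat> \<Longrightarrow> s < r \<Longrightarrow> a r q \<longleftrightarrow> q < l r"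
    and t: "s \<le> t" "t \<le> T"
  shows "Lim (at_right t) (staircase s C (halted s C R a)) = Lim (at_right t) l"
proof -
  let ?L = "staircase s C a" and ?H = "staircase s C (halted s C R a)" and ?\<tau> = "ruin_at s R l"
  have m: "mono_on {s..} l" and l0: "l s = 0" and cl: "caglad_from s l"
    and before: "\<And>t. s \<le> t \<Longrightarrow> t \<le> T \<Longrightarrow> ereal t < ?\<tau> \<Longrightarrow> Lim (at_right t) l \<le> R t"
    and after: "\<And>t. s \<le> t \<Longrightarrow> t \<le> T \<Longrightarrow> ?\<tau> \<le> ereal t \<Longrightarrow> Lim (at_right t) l = l (real_of_ereal ?\<tau>)"
    using adm by (auto simp: admissible_path_def)
  have L: "?L u = min (l u) C" if "s \<le> u" for u
  proof (rule staircase_of_path[where l=l and s=s])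
    show "a r q \<longleftrightarrow> q < l r" if "r \<in> \<rat>" "q \<in> \<rat>" "s < r" for r q
      using a[OF that] .
  qed (fact m l0 cl \<open>0 \<le> C\<close> that)+
  have H: "staircase s C (halted s C R a) u = min (l u) C" if "s \<le> u" "ereal u \<le> ruin_at s R l" for u :: real
  proof -
    have "?H u = ?L u"
    proof (rule halted_eq[of s u])
      fix v assume "v \<in> \<rat>" "s < v" "v < u"
      then have "ereal v < ruin_at s R l" by (auto intro!: less_le_trans[OF _ that(2)])
      then have "l v \<le> R v" using solvent_before_ruin[of s v R l] \<open>s < v\<close> by simp
      then show "?L v \<le> R v" using L[of v] \<open>s < v\<close> by simp
    qed simp
    then show ?thesis using L that by simp
  qed
  show ?thesis
  proof (cases "ereal t < ?\<tau>")
    case True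
    have lim: "((\<lambda>u. min (l u) C) \<longlongrightarrow> min (Lim (at_right t) l) C) (at_right t)"
      by (intro tendsto_intros mono_right_limit[OF m t(1)])
    obtain b where "ereal t < ereal b" "ereal b < ?\<tau>" using ereal_dense2[OF True] by blast
    then have b: "t < b" "ereal b \<le> ?\<tau>" by simp_all
    have "\<forall>\<^sub>F u in at_right t. min (l u) C = ?H u"
      unfolding eventually_at_right_field
    proof (intro exI[of _ b] conjI allI impI)
      fix u assume "t < u" "u < b"
      then have "ereal u \<le> ?\<tau>" by (auto intro!: order_trans[OF _ b(2)])
      then show "min (l u) C = ?H u" using H[of u] t \<open>t < u\<close> by simp
    qed (rule b)
    then have "(?H \<longlongrightarrow> min (Lim (at_right t) l) C) (at_right t)"
      using lim by (rule Lim_transform_eventually[rotated])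
    then have "Lim (at_right t) ?H = min (Lim (at_right t) l) C"
      by (intro tendsto_Lim) auto
    moreover have "Lim (at_right t) l \<le> C" using before[OF t True] RC[OF t] by simp
    ultimately show ?thesis by simp
  next
    case False
    then have "?\<tau> \<le> ereal t" by simp
    then obtain u where u: "?\<tau> = ereal u" "s \<le> u" "u \<le> t" by (rule ruin_at_realE)
    have "l u \<le> C"
    proof (cases "s = u")
      case True
      then show ?thesis using l0 \<open>0 \<le> C\<close> by simp
    next
      case False
      have ev: "\<forall>\<^sub>F v in at_left u. l v \<le> C"
        unfolding eventually_at_left_field
      proof (intro exI[of _ s] conjI allI impI)
        show "s < u" using False u by simp
        fix v assume v: "s < v" "v < u"
        then have "l v \<le> R v" using solvent_before_ruin[of s v R l] u by simp
        then show "l v \<le> C" using RC[of v] v u t by simp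
      qed
      have "(l \<longlongrightarrow> l u) (at_left u)" using cl False u by (auto simp: caglad_from_def)
      from tendsto_upperbound[OF this ev] show ?thesis by simp
    qed
    have lt: "Lim (at_right t) l = l u" using after[OF t] False u by simp
    note mH = staircase_mono_on[of "{s..}" s C "halted s C R a"]
    have "?H u = min (l u) C" by (rule H[OF u(2)]) (simp add: u(1))
    then have "l u = ?H u" using \<open>l u \<le> C\<close> by simp
    then have 1: "l u \<le> Lim (at_right t) ?H"
      using mono_right_limit(3)[OF mH t(1)] staircase_mono[OF u(3), of s C "halted s C R a"] by linarith
    have "?H v \<le> l v" if "t < v" for v
      using halted_le[of s C R a v] L[of v] t(1) that by linarith
    then have "\<forall>\<^sub>F v in at_right t. ?H v \<le> l v"
      unfolding eventually_at_filter by (intro always_eventually allI impI) simp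
    then have "Lim (at_right t) ?H \<le> Lim (at_right t) l"
      using mono_right_limit(1)[OF m t(1)] mono_right_limit(1)[OF mH t(1)]
      by (intro tendsto_le[where F="at_right t" and f=l and g="?H"]) simp_all
    with 1 lt show ?thesis by simp
  qed
qed

section \<open>Discounted dividends of an admissible path\<close>

text \<open>
  The distribution function of the dividend measure: lump sums at \<open>t\<close> are included, and the jump
  from 0 at \<open>s\<close> is the initial lump sum.
\<close>
definition paid_by :: "real \<Rightarrow> (real \<Rightarrow> real) \<Rightarrow> real \<Rightarrow> real" where
  "paid_by s l t = (if t < s then 0 else Lim (at_right t) l)"

lemma
  assumes m: "mono_on {s..} l" and l0: "l s = 0"
  shows paid_by_mono: "\<And>t u. t \<le> u \<Longrightarrow> paid_by s l t \<le> paid_by s l u"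
    and paid_by_nonneg: "\<And>t. 0 \<le> paid_by s l t"
    and paid_by_right_continuous: "\<And>t. continuous (at_right t) (paid_by s l)"
proof -
  show nn: "0 \<le> paid_by s l t" for t
    using mono_right_limit(3)[OF m, of t] mono_onD[OF m, of s t] l0 by (auto simp: paid_by_def)
  show mon: "paid_by s l t \<le> paid_by s l u" if tu: "t \<le> u" for t u
  proof (cases "t < s \<or> t = u")
    case True
    then show ?thesis using nn[of u] by (auto simp: paid_by_def)
  next
    case False
    then have "Lim (at_right t) l \<le> l u" "l u \<le> Lim (at_right u) l"
      using mono_right_limit(2)[OF m, of t u] mono_right_limit(3)[OF m, of u] tu by auto
    then show ?thesis using False tu by (auto simp: paid_by_def)
  qed
  show "continuous (at_right t) (paid_by s l)" for t
    unfolding continuous_within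
  proof (rule order_tendstoI)
    fix y assume y: "y < paid_by s l t"
    have "y < paid_by s l u" if "t < u" for u using y mon[of t u] that by simp
    then show "\<forall>\<^sub>F u in at_right t. y < paid_by s l u"
      unfolding eventually_at_filter by (intro always_eventually) auto
  next
    fix y assume y: "paid_by s l t < y"
    show "\<forall>\<^sub>F u in at_right t. paid_by s l u < y"
    proof (cases "t < s")
      case True
      then show ?thesis using y
        unfolding eventually_at_right_field by (intro exI[of _ s]) (auto simp: paid_by_def)
    next
      case False
      then have "\<forall>\<^sub>F u in at_right t. l u < y"
        using order_tendstoD(2)[OF mono_right_limit(1)[OF m, of t]] y by (simp add: paid_by_def)
      then obtain b where b: "t < b" "\<And>u. t < u \<Longrightarrow> u < b \<Longrightarrow> l u < y"
        unfolding eventually_at_right_field by blast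
      have "paid_by s l u < y" if u: "t < u" "u < b" for u
      proof -
        obtain v where v: "u < v" "v < b" using dense[OF u(2)] by blast
        then have "Lim (at_right u) l \<le> l v" using mono_right_limit(2)[OF m, of u v] u False by simp
        then show ?thesis using b(2)[of v] u v False by (auto simp: paid_by_def)
      qed
      then show ?thesis unfolding eventually_at_right_field using b(1) by blast
    qed
  qed
qed

definition payout :: "real \<Rightarrow> real \<Rightarrow> real \<Rightarrow> (real \<Rightarrow> real) \<Rightarrow> ennreal" where
  "payout c s b l =
     (\<integral>\<^sup>+t\<in>{s..b}. ennreal (exp (- c * (t - s))) \<partial>interval_measure (paid_by s l))"

text \<open>
  The integral of the discount factor against the dividend measure on \<open>[s, b]\<close> after integration by
  parts, for cumulative dividends \<open>k\<close> with lump sums included.  It involves \<open>k\<close> only through its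
  values and a Lebesgue integral, so it depends measurably on the path.
\<close>
definition discounted_total :: "real \<Rightarrow> real \<Rightarrow> real \<Rightarrow> (real \<Rightarrow> real) \<Rightarrow> ennreal" where
  "discounted_total c s b k =
     ennreal (exp (- c * (b - s)) * k b) + (\<integral>\<^sup>+u\<in>{s..b}. ennreal (c * exp (- c * (u - s)) * k u) \<partial>lborel)"

text \<open>
  The atom at \<open>s\<close> counts.  The interval is enlarged to \<open>{s - 1<..u}\<close>, which is harmless because the
  distribution function vanishes to the left of \<open>s\<close>.
\<close>
lemma emeasure_paid_by:
  assumes m: "mono_on {s..} l" and l0: "l s = 0" and "s \<le> u"
  shows "emeasure (interval_measure (paid_by s l)) {s..u} = ennreal (paid_by s l u)"
proof -
  let ?M = "interval_measure (paid_by s l)"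
  note Ioc = emeasure_interval_measure_Ioc[of _ _ "paid_by s l",
      OF _ paid_by_mono[OF m l0] paid_by_right_continuous[OF m l0]]
  have "(\<Union>n. {s - 1<..s - 1 / real (n + 2)}) \<in> null_sets ?M"
  proof (rule null_sets_UN)
    fix n
    have "s - 1 \<le> s - 1 / real (n + 2)" by simp
    from Ioc[OF this] show "{s - 1<..s - 1 / real (n + 2)} \<in> null_sets ?M"
      by (intro null_setsI) (auto simp: paid_by_def)
  qed
  moreover have "(\<Union>n. {s - 1<..s - 1 / real (n + 2)}) = {s - 1<..<s}"
  proof (intro equalityI subsetI)
    fix x assume x: "x \<in> {s - 1<..<s}"
    then obtain n where "1 / real (Suc n) < s - x" using nat_approx_posE[of "s - x"] by auto
    moreover have "1 / real (n + 2) \<le> 1 / real (Suc n)" by (intro divide_left_mono) auto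
    ultimately have "x \<le> s - 1 / real (n + 2)" by linarith
    then show "x \<in> (\<Union>n. {s - 1<..s - 1 / real (n + 2)})" using x by (intro UN_I[of n]) simp_all
  next
    fix x assume "x \<in> (\<Union>n. {s - 1<..s - 1 / real (n + 2)})"
    then obtain n where "s - 1 < x" "x \<le> s - 1 / real (n + 2)" by auto
    moreover have "0 < 1 / real (n + 2)" by simp
    ultimately have "s - 1 < x" "x < s" by linarith+
    then show "x \<in> {s - 1<..<s}" by simp
  qed
  ultimately have null: "{s - 1<..<s} \<in> null_sets ?M" by simp
  have "emeasure ?M {s..u} = emeasure ?M ({s..u} \<union> {s - 1<..<s})"
    by (rule emeasure_Un_null_set[symmetric]) (use null in auto)
  also have "{s..u} \<union> {s - 1<..<s} = {s - 1<..u}" using \<open>s \<le> u\<close> by auto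
  also have "emeasure ?M \<dots> = ennreal (paid_by s l u)"
    using Ioc[of "s - 1" u] \<open>s \<le> u\<close> by (simp add: paid_by_def)
  finally show ?thesis .
qed

text \<open>
  Integration by parts, obtained from Fubini: the discount factor at \<open>t\<close> is its value at \<open>b\<close> plus
  the integral of its rate of decrease over \<open>[t, b]\<close>.
\<close>
lemma payout_eq_discounted_total:
  assumes m: "mono_on {s..} l" and l0: "l s = 0" and sb: "s \<le> b" and c: "0 < c"
  shows "payout c s b l = discounted_total c s b (\<lambda>t. Lim (at_right t) l)"
proof -
  let ?M = "interval_measure (paid_by s l)"
  define h where "h u = c * exp (- c * (u - s))" for u
  interpret I: sigma_finite_measure ?M
    by (rule sigma_finite_interval_measure[OF paid_by_mono[OF m l0] paid_by_right_continuous[OF m l0]])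
  interpret pair_sigma_finite ?M lborel by standard
  have h[measurable]: "h \<in> borel_measurable borel" unfolding h_def by measurable
  have h0: "0 \<le> h u" for u using c by (simp add: h_def)
  have E: "ennreal (exp (- c * (t - s))) =
      ennreal (exp (- c * (b - s))) + (\<integral>\<^sup>+u. ennreal (h u) * indicator {t..b} u \<partial>lborel)" if "t \<le> b" for t
  proof -
    have "(\<integral>\<^sup>+u. ennreal (h u) * indicator {t..b} u \<partial>lborel)
        = ennreal (- exp (- c * (b - s)) - - exp (- c * (t - s)))"
    proof (rule nn_integral_FTC_Icc)
      show "((\<lambda>u. - exp (- c * (u - s))) has_real_derivative h u) (at u)" for u
        unfolding h_def by (auto intro!: derivative_eq_intros)
    qed (use that h0 in auto)
    moreover have "exp (- c * (b - s)) \<le> exp (- c * (t - s))" using c that by simp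
    ultimately show ?thesis
      by (simp add: ennreal_plus[symmetric] del: ennreal_plus)
  qed
  have "payout c s b l = (\<integral>\<^sup>+t. ennreal (exp (- c * (b - s))) * indicator {s..b} t
      + (\<integral>\<^sup>+u. ennreal (h u) * indicator {t..b} u * indicator {s..b} t \<partial>lborel) \<partial>?M)"
    unfolding payout_def
  proof (intro nn_integral_cong)
    fix t
    show "ennreal (exp (- c * (t - s))) * indicator {s..b} t =
        ennreal (exp (- c * (b - s))) * indicator {s..b} t
        + (\<integral>\<^sup>+u. ennreal (h u) * indicator {t..b} u * indicator {s..b} t \<partial>lborel)"
      using E[of t] by (cases "t \<in> {s..b}") auto
  qed
  also have "\<dots> = (\<integral>\<^sup>+t. ennreal (exp (- c * (b - s))) * indicator {s..b} t \<partial>?M)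
      + (\<integral>\<^sup>+t. \<integral>\<^sup>+u. ennreal (h u) * indicator {t..b} u * indicator {s..b} t \<partial>lborel \<partial>?M)"
    by (rule nn_integral_add) (simp_all add: indicator_def)
  also have "(\<integral>\<^sup>+t. ennreal (exp (- c * (b - s))) * indicator {s..b} t \<partial>?M)
      = ennreal (exp (- c * (b - s)) * paid_by s l b)"
    by (simp add: nn_integral_cmult emeasure_paid_by[OF m l0 sb] ennreal_mult
        paid_by_nonneg[OF m l0])
  also have "(\<integral>\<^sup>+t. \<integral>\<^sup>+u. ennreal (h u) * indicator {t..b} u * indicator {s..b} t \<partial>lborel \<partial>?M)
      = (\<integral>\<^sup>+u. \<integral>\<^sup>+t. ennreal (h u) * indicator {t..b} u * indicator {s..b} t \<partial>?M \<partial>lborel)"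
    by (rule Fubini'[symmetric]) (simp add: indicator_def)
  also have "\<dots> = (\<integral>\<^sup>+u\<in>{s..b}. ennreal (h u * paid_by s l u) \<partial>lborel)"
  proof (intro nn_integral_cong)
    fix u
    have "ennreal (h u) * indicator {t..b} u * indicator {s..b} t
        = ennreal (h u) * indicator {s..b} u * indicator {s..u} t" for t
      by (auto simp: indicator_def)
    then have "(\<integral>\<^sup>+t. ennreal (h u) * indicator {t..b} u * indicator {s..b} t \<partial>?M)
        = ennreal (h u) * indicator {s..b} u * emeasure ?M {s..u}"
      by (simp add: nn_integral_cmult)
    then show "(\<integral>\<^sup>+t. ennreal (h u) * indicator {t..b} u * indicator {s..b} t \<partial>?M)
        = ennreal (h u * paid_by s l u) * indicator {s..b} u"
      using emeasure_paid_by[OF m l0, of u] paid_by_nonneg[OF m l0, of u]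
      by (cases "u \<in> {s..b}") (simp_all add: ennreal_mult h0)
  qed
  also have "ennreal (exp (- c * (b - s)) * paid_by s l b) + \<dots>
      = discounted_total c s b (\<lambda>t. Lim (at_right t) l)"
    unfolding discounted_total_def h_def
    using sb by (intro arg_cong2[where f="(+)"] nn_integral_cong) (auto simp: paid_by_def indicator_def)
  finally show ?thesis .
qed

text \<open>
  No dividends are paid after ruin, so the integral up to ruin may be extended to \<open>T\<close>.  This
  eliminates the ruin time from the payoff.
\<close>
lemma payout_admissible:
  assumes adm: "admissible_path s T R l" and "s \<le> T" "0 < c"
  shows "payout c s (real_of_ereal (min (ruin_at s R l) (ereal T))) l
    = discounted_total c s T (\<lambda>t. Lim (at_right t) l)"
proof -
  let ?M = "interval_measure (paid_by s l)"
  have m: "mono_on {s..} l" and l0: "l s = 0" using adm by (auto simp: admissible_path_def)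
  have "payout c s (real_of_ereal (min (ruin_at s R l) (ereal T))) l = payout c s T l"
  proof (cases "ereal T \<le> ruin_at s R l")
    case True
    then show ?thesis by (simp add: min_absorb2)
  next
    case False
    then have "ruin_at s R l \<le> ereal T" by simp
    then obtain u where u: "ruin_at s R l = ereal u" "s \<le> u" "u \<le> T" by (rule ruin_at_realE)
    have "paid_by s l T = paid_by s l u"
      using adm u by (auto simp: admissible_path_def paid_by_def)
    then have "emeasure ?M {u<..T} = 0"
      using emeasure_interval_measure_Ioc[of u T "paid_by s l",
          OF u(3) paid_by_mono[OF m l0] paid_by_right_continuous[OF m l0]] by simp
    then have "AE t in ?M. t \<notin> {u<..T}"
      by (intro AE_not_in null_setsI) auto
    then have "payout c s u l = payout c s T l"
      unfolding payout_def
      by (intro nn_integral_cong_AE, elim AE_mp) (use u in \<open>auto simp: indicator_def\<close>)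
    then show ?thesis using u by simp
  qed
  also have "\<dots> = discounted_total c s T (\<lambda>t. Lim (at_right t) l)"
    by (rule payout_eq_discounted_total) (use assms m l0 in auto)
  finally show ?thesis .
qed

lemma discounted_total_le:
  assumes "\<And>t. s \<le> t \<Longrightarrow> t \<le> b \<Longrightarrow> 0 \<le> k t \<and> k t \<le> C" "s \<le> b" "0 < c"
  shows "discounted_total c s b k \<le> ennreal C"
proof -
  have C: "0 \<le> C" using assms(1)[of b] assms(2) by auto
  have "(\<integral>\<^sup>+u\<in>{s..b}. ennreal (c * exp (- c * (u - s)) * k u) \<partial>lborel)
      \<le> (\<integral>\<^sup>+u\<in>{s..b}. ennreal (c * exp (- c * (u - s)) * C) \<partial>lborel)"
    by (rule nn_integral_mono) (use assms in \<open>auto simp: indicator_def intro!: ennreal_leI mult_left_mono\<close>)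
  also have "\<dots> = ennreal (- exp (- c * (b - s)) * C - - exp (- c * (s - s)) * C)"
  proof (rule nn_integral_FTC_Icc)
    show "((\<lambda>u. - exp (- c * (u - s)) * C) has_real_derivative c * exp (- c * (u - s)) * C)
        (at u)" for u
      by (auto intro!: derivative_eq_intros)
  qed (use assms C in auto)
  finally have "discounted_total c s b k
      \<le> ennreal (exp (- c * (b - s)) * C) + ennreal (C - exp (- c * (b - s)) * C)"
    unfolding discounted_total_def
    by (intro add_mono ennreal_leI mult_left_mono) (use assms in simp_all)
  also have "\<dots> = ennreal C"
  proof -
    have "exp (- c * (b - s)) * C \<le> 1 * C"
      using assms C by (intro mult_right_mono) auto
    then show ?thesis using C by (simp add: ennreal_plus[symmetric] del: ennreal_plus)
  qed
  finally show ?thesis .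
qed

section \<open>Measurability of rebuilt strategies\<close>

lemma staircase_measurable:
  assumes "\<And>r q. r \<in> \<rat> \<Longrightarrow> q \<in> \<rat> \<Longrightarrow> s < r \<Longrightarrow> {z \<in> space N. r < \<theta> z \<and> a z r q} \<in> sets N"
  shows "(\<lambda>z. staircase s C (a z) (\<theta> z)) \<in> borel_measurable N"
  unfolding borel_measurable_iff_greater
proof
  fix y
  show "{z \<in> space N. y < staircase s C (a z) (\<theta> z)} \<in> sets N"
  proof (cases "y < 0")
    case True
    then show ?thesis by (simp add: less_staircase_iff)
  next
    case False
    have "{z \<in> space N. y < staircase s C (a z) (\<theta> z)} =
        (\<Union>q\<in>\<rat> \<inter> {q. y < q \<and> 0 \<le> q \<and> q \<le> C}. \<Union>r\<in>\<rat> \<inter> {s<..}. {z \<in> space N. r < \<theta> z \<and> a z r q})"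
      using False unfolding less_staircase_iff by blast
    also have "\<dots> \<in> sets N"
      by (intro sets.countable_UN'' countable_Int1 countable_rat) (use assms in auto)
    finally show ?thesis .
  qed
qed

lemma halted_sets:
  assumes a: "\<And>r' q'. r' \<in> \<rat> \<Longrightarrow> q' \<in> \<rat> \<Longrightarrow> s < r' \<Longrightarrow> r' < r \<Longrightarrow> {z \<in> space N. a z r' q'} \<in> sets N"
    and R: "\<And>v. s < v \<Longrightarrow> v < r \<Longrightarrow> (\<lambda>z. R z v) \<in> borel_measurable N"
  shows "{z \<in> space N. halted s C (R z) (a z) r q} \<in> sets N"
proof -
  have st[measurable]: "(\<lambda>z. staircase s C (a z) v) \<in> borel_measurable N" if "v \<le> r" for v
  proof (rule staircase_measurable)
    fix r' q' :: real assume "r' \<in> \<rat>" "q' \<in> \<rat>" "s < r'"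
    then show "{z \<in> space N. r' < v \<and> a z r' q'} \<in> sets N"
      using a[of r' q'] that by (cases "r' < v") auto
  qed
  have "{z \<in> space N. halted s C (R z) (a z) r q} =
      {z \<in> space N. q < staircase s C (a z) r} \<inter>
      {z \<in> space N. \<forall>v\<in>\<rat> \<inter> {s<..<r}. staircase s C (a z) v \<le> R z v}"
    unfolding halted_def by auto
  also have "\<dots> \<in> sets N"
  proof (intro sets.Int sets.sets_Collect_countable_All' countable_Int1 countable_rat)
    fix v assume "v \<in> \<rat> \<inter> {s<..<r}"
    then have [measurable]: "(\<lambda>z. R z v) \<in> borel_measurable N" "(\<lambda>z. staircase s C (a z) v) \<in> borel_measurable N"
      using R st by auto
    show "{z \<in> space N. staircase s C (a z) v \<le> R z v} \<in> sets N" by measurable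
  qed (use st[of r] in measurable)
  finally show ?thesis .
qed

text \<open>
  Right limits are taken along \<open>t + 1 / n\<close>, so they are limits of jointly measurable functions.
\<close>
lemma discounted_total_staircase_measurable:
  assumes a: "\<And>r q. r \<in> \<rat> \<Longrightarrow> q \<in> \<rat> \<Longrightarrow> s < r \<Longrightarrow> {z \<in> space N. a z r q} \<in> sets N"
  shows "(\<lambda>z. discounted_total c s b (\<lambda>t. Lim (at_right t) (staircase s C (a z)))) \<in> borel_measurable N"
proof -
  have st[measurable]: "(\<lambda>(z, t). staircase s C (a z) t) \<in> borel_measurable (N \<Otimes>\<^sub>M borel)"
    unfolding case_prod_beta
  proof (rule staircase_measurable)
    fix r q :: real assume "r \<in> \<rat>" "q \<in> \<rat>" "s < r"
    then have "{z \<in> space N. a z r q} \<times> {r<..} \<in> sets (N \<Otimes>\<^sub>M borel)" using a by auto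
    moreover have "{z \<in> space (N \<Otimes>\<^sub>M borel). r < snd z \<and> a (fst z) r q} = {z \<in> space N. a z r q} \<times> {r<..}"
      by (auto simp: space_pair_measure)
    ultimately show "{z \<in> space (N \<Otimes>\<^sub>M borel). r < snd z \<and> a (fst z) r q} \<in> sets (N \<Otimes>\<^sub>M borel)" by simp
  qed
  have eq: "Lim (at_right t) (staircase s C (a z)) = lim (\<lambda>n. staircase s C (a z) (t + 1 / real (Suc n)))" for z t
  proof -
    have "filterlim (\<lambda>n. t + 1 / real (Suc n)) (at_right t) sequentially"
      unfolding filterlim_at
    proof (intro conjI)
      show "(\<lambda>n. t + 1 / real (Suc n)) \<longlonglongrightarrow> t"
        using tendsto_add[OF tendsto_const LIMSEQ_inverse_real_of_nat, of t] by (simp add: inverse_eq_divide)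
    qed (auto intro!: always_eventually)
    from filterlim_compose[OF mono_right_limit(1)[OF staircase_mono_on[of "{t..}" s C "a z"], of t] this]
    show ?thesis by (intro limI[symmetric]) simp
  qed
  have [measurable]: "(\<lambda>(z, t). Lim (at_right t) (staircase s C (a z))) \<in> borel_measurable (N \<Otimes>\<^sub>M borel)"
    unfolding eq by measurable
  show ?thesis
    unfolding discounted_total_def by measurable
qed

lemma vimage_algebra_subset_Pow: "sets (vimage_algebra \<Omega> g B) \<subseteq> Pow \<Omega>"
  using sets.space_closed[of "vimage_algebra \<Omega> g B"] by simp

lemma claim_history_generators:
  "(\<Union>r\<in>{0..t}. sets (vimage_algebra \<Omega> (claim_count Y r) (count_space UNIV))
                \<union> sets (vimage_algebra \<Omega> (total_claim Y U r) borel)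
                \<union> sets (vimage_algebra \<Omega> (clock Y r) borel)) \<subseteq> Pow \<Omega>"
  by (intro UN_least Un_least vimage_algebra_subset_Pow)

lemma space_claim_history[simp]: "space (claim_history \<Omega> Y U t) = \<Omega>"
  unfolding claim_history_def using claim_history_generators by (rule space_measure_of)

lemma sets_claim_history:
  "sets (claim_history \<Omega> Y U t) = sigma_sets \<Omega> (\<Union>r\<in>{0..t}.
      sets (vimage_algebra \<Omega> (claim_count Y r) (count_space UNIV))
                \<union> sets (vimage_algebra \<Omega> (total_claim Y U r) borel)
                \<union> sets (vimage_algebra \<Omega> (clock Y r) borel))"
  unfolding claim_history_def using claim_history_generators by (rule sets_measure_of)

lemma claim_history_mono: "t \<le> t' \<Longrightarrow> sets (claim_history \<Omega> Y U t) \<subseteq> sets (claim_history \<Omega> Y U t')"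
  unfolding sets_claim_history by (intro sigma_sets_mono' UN_mono) auto

lemma
  assumes "0 \<le> r" "r \<le> t"
  shows claim_count_history: "claim_count Y r \<in> claim_history \<Omega> Y U t \<rightarrow>\<^sub>M count_space UNIV"
    and total_claim_history: "total_claim Y U r \<in> borel_measurable (claim_history \<Omega> Y U t)"
    and clock_history: "clock Y r \<in> borel_measurable (claim_history \<Omega> Y U t)"
proof -
  have gen: "g \<in> claim_history \<Omega> Y U t \<rightarrow>\<^sub>M B"
    if "sets (vimage_algebra \<Omega> g B) \<subseteq> sets (claim_history \<Omega> Y U t)" "space B = UNIV"
    for g :: "'a \<Rightarrow> 'z" and B
    using that in_vimage_algebra[of _ B g \<Omega>] by (intro measurableI) auto
  have sub: "sets (vimage_algebra \<Omega> (claim_count Y r) (count_space UNIV)) \<subseteq> sets (claim_history \<Omega> Y U t)"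
    "sets (vimage_algebra \<Omega> (total_claim Y U r) borel) \<subseteq> sets (claim_history \<Omega> Y U t)"
    "sets (vimage_algebra \<Omega> (clock Y r) borel) \<subseteq> sets (claim_history \<Omega> Y U t)"
    unfolding sets_claim_history using assms by (auto intro!: sigma_sets.Basic bexI[of _ r])
  show "claim_count Y r \<in> claim_history \<Omega> Y U t \<rightarrow>\<^sub>M count_space UNIV"
    by (rule gen[OF sub(1)]) simp
  show "total_claim Y U r \<in> borel_measurable (claim_history \<Omega> Y U t)"
    by (rule gen[OF sub(2)]) simp
  show "clock Y r \<in> borel_measurable (claim_history \<Omega> Y U t)"
    by (rule gen[OF sub(3)]) simp
qed

lemma sets_claim_history_least:
  assumes "space N = \<Omega>"
    and "\<And>r. 0 \<le> r \<Longrightarrow> r \<le> t \<Longrightarrow> claim_count Y r \<in> N \<rightarrow>\<^sub>M count_space UNIV"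
    and "\<And>r. 0 \<le> r \<Longrightarrow> r \<le> t \<Longrightarrow> total_claim Y U r \<in> borel_measurable N"
    and "\<And>r. 0 \<le> r \<Longrightarrow> r \<le> t \<Longrightarrow> clock Y r \<in> borel_measurable N"
  shows "sets (claim_history \<Omega> Y U t) \<subseteq> sets N"
proof -
  have sub: "sets (vimage_algebra \<Omega> g B) \<subseteq> sets N" if "g \<in> N \<rightarrow>\<^sub>M B" for g and B :: "'z measure"
    using that measurable_space[OF that] measurable_sets[OF that] assms(1)
    by (subst sets_vimage_algebra2) auto
  show ?thesis
    unfolding sets_claim_history assms(1)[symmetric]
    by (intro sets.sigma_sets_subset UN_least Un_least; unfold assms(1); rule sub; rule assms(2-)) auto
qed

lemma aug_history_generators:
  "sets (claim_history (space P) Y U t) \<union> null_sets (completion P) \<subseteq> Pow (space P)"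
  using sets.space_closed[of "claim_history (space P) Y U t"] sets.space_closed[of "completion P"]
  by (auto simp: null_sets_def)

lemma space_aug_history[simp]: "space (aug_history P Y U t) = space P"
  unfolding aug_history_def using aug_history_generators by (rule space_measure_of)

lemma sets_aug_history:
  "sets (aug_history P Y U t) =
     sigma_sets (space P) (sets (claim_history (space P) Y U t) \<union> null_sets (completion P))"
  unfolding aug_history_def using aug_history_generators by (rule sets_measure_of)

lemma aug_history_mono: "t \<le> t' \<Longrightarrow> sets (aug_history P Y U t) \<subseteq> sets (aug_history P Y U t')"
  unfolding sets_aug_history using claim_history_mono[of t t' "space P" Y U]
  by (intro sigma_sets_mono') auto

lemma claim_history_subset_aug: "sets (claim_history (space P) Y U t) \<subseteq> sets (aug_history P Y U t)"
  unfolding sets_aug_history by (auto intro: sigma_sets.Basic)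

text \<open>
  The sets that are almost surely equal to a set of the raw filtration form a sigma-algebra, which
  contains all null sets.
\<close>
lemma aug_history_approx:
  assumes "A \<in> sets (aug_history P Y U t)"
  shows "\<exists>B\<in>sets (claim_history (space P) Y U t). AE \<omega> in P. \<omega> \<in> A \<longleftrightarrow> \<omega> \<in> B"
  using assms unfolding sets_aug_history
proof induction
  case (Basic A)
  then show ?case
  proof
    assume "A \<in> null_sets (completion P)"
    then have "AE \<omega> in P. \<omega> \<notin> A" using AE_not_in AE_completion_iff by blast
    then show ?thesis by (intro bexI[of _ "{}"]) auto
  qed blast
next
  case Empty
  then show ?case by (intro bexI[of _ "{}"]) auto
next
  case (Compl A)
  then obtain B where B: "B \<in> sets (claim_history (space P) Y U t)" "AE \<omega> in P. \<omega> \<in> A \<longleftrightarrow> \<omega> \<in> B" by blast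
  have "space P - B \<in> sets (claim_history (space P) Y U t)"
    using sets.compl_sets[OF B(1)] by simp
  then show ?case using B(2) by (intro bexI[of _ "space P - B"]) auto
next
  case (Union A)
  then obtain B where B: "\<And>i::nat. B i \<in> sets (claim_history (space P) Y U t)"
      "\<And>i. AE \<omega> in P. \<omega> \<in> A i \<longleftrightarrow> \<omega> \<in> B i" by metis
  have "AE \<omega> in P. \<forall>i. \<omega> \<in> A i \<longleftrightarrow> \<omega> \<in> B i" using B(2) by (simp add: AE_all_countable)
  then have "AE \<omega> in P. \<omega> \<in> (\<Union>i. A i) \<longleftrightarrow> \<omega> \<in> (\<Union>i. B i)" by eventually_elim blast
  then show ?case using B(1) by (intro bexI[of _ "\<Union>i. B i"]) auto
qed

lemma predictable_generators:
  fixes s :: real and \<F> :: "real \<Rightarrow> 'a measure"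
  assumes "\<And>u. sets (\<F> u) \<subseteq> Pow \<Omega>"
  shows "{{s} \<times> A | A. A \<in> sets (\<F> s)} \<union> {{u<..v} \<times> A | u v A. s \<le> u \<and> u < v \<and> A \<in> sets (\<F> u)}
    \<subseteq> Pow ({s..} \<times> \<Omega>)"
proof -
  have "A \<subseteq> \<Omega>" if "A \<in> sets (\<F> u)" for A u using assms[of u] that by blast
  then show ?thesis by (auto dest!: subsetD)
qed

text \<open>
  The section at time \<open>r\<close> of a generator is empty or an event known at some time \<open>u \<le> r\<close>.
\<close>
lemma predictable_adapted:
  fixes \<F> :: "real \<Rightarrow> 'a measure"
  assumes sp: "\<And>u. space (\<F> u) = \<Omega>" and mono: "\<And>u v. u \<le> v \<Longrightarrow> sets (\<F> u) \<subseteq> sets (\<F> v)"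
    and L: "case_prod L \<in> borel_measurable (predictable_algebra \<Omega> s \<F>)" and "s \<le> r"
  shows "L r \<in> borel_measurable (\<F> r)"
proof -
  have gen: "{{s} \<times> A | A. A \<in> sets (\<F> s)} \<union> {{u<..v} \<times> A | u v A. s \<le> u \<and> u < v \<and> A \<in> sets (\<F> u)}
      \<subseteq> Pow ({s..} \<times> \<Omega>)"
    by (rule predictable_generators) (use sets.space_closed sp in blast)
  have "Pair r \<in> \<F> r \<rightarrow>\<^sub>M predictable_algebra \<Omega> s \<F>"
    unfolding predictable_algebra_def
  proof (rule measurable_measure_of[OF gen])
    show "Pair r \<in> space (\<F> r) \<rightarrow> {s..} \<times> \<Omega>" using sp \<open>s \<le> r\<close> by auto
    fix B assume "B \<in> {{s} \<times> A | A. A \<in> sets (\<F> s)} \<union> {{u<..v} \<times> A | u v A. s \<le> u \<and> u < v \<and> A \<in> sets (\<F> u)}"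
    then obtain A I u where B: "B = I \<times> A" "A \<in> sets (\<F> u)" "r \<in> I \<Longrightarrow> u \<le> r"
      by (elim UnE CollectE exE conjE) fastforce+
    have "Pair r -` B \<inter> space (\<F> r) = (if r \<in> I then A else {})"
      using B sets.sets_into_space[OF B(2)] sp by auto
    then show "Pair r -` B \<inter> space (\<F> r) \<in> sets (\<F> r)"
      using B mono[of u r] by auto
  qed
  from measurable_compose[OF this L] show ?thesis by simp
qed

text \<open>
  A level accepted at \<open>r\<close> affects the path on the open ray after \<open>r\<close>, and the product of such a ray
  with an event known at \<open>r\<close> is predictable.
\<close>
lemma staircase_predictable:
  fixes \<F> :: "real \<Rightarrow> 'a measure"
  assumes sp: "\<And>u. space (\<F> u) = \<Omega>"
    and a: "\<And>r q. r \<in> \<rat> \<Longrightarrow> q \<in> \<rat> \<Longrightarrow> s < r \<Longrightarrow> {\<omega> \<in> \<Omega>. a \<omega> r q} \<in> sets (\<F> r)"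
  shows "(\<lambda>(t, \<omega>). staircase s C (a \<omega>) t) \<in> borel_measurable (predictable_algebra \<Omega> s \<F>)"
  unfolding case_prod_beta
proof (rule staircase_measurable)
  fix r q :: real assume rq: "r \<in> \<rat>" "q \<in> \<rat>" "s < r"
  have gen: "{{s} \<times> A | A. A \<in> sets (\<F> s)} \<union> {{u<..v} \<times> A | u v A. s \<le> u \<and> u < v \<and> A \<in> sets (\<F> u)}
      \<subseteq> Pow ({s..} \<times> \<Omega>)"
    by (rule predictable_generators) (use sets.space_closed sp in blast)
  have space: "space (predictable_algebra \<Omega> s \<F>) = {s..} \<times> \<Omega>"
    unfolding predictable_algebra_def using gen by (rule space_measure_of)
  have "{z \<in> space (predictable_algebra \<Omega> s \<F>). r < fst z \<and> a (snd z) r q}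
      = (\<Union>n. {r<..r + real (Suc n)} \<times> {\<omega> \<in> \<Omega>. a \<omega> r q})"
  proof -
    have "\<exists>n. t \<le> r + real (Suc n)" for t
    proof -
      obtain n where "t - r \<le> real n" using real_arch_simple[of "t - r"] by blast
      then show ?thesis by (intro exI[of _ n]) simp
    qed
    then show ?thesis using rq(3) unfolding space by fastforce
  qed
  also have "\<dots> \<in> sets (predictable_algebra \<Omega> s \<F>)"
  proof (rule sets.countable_nat_UN, rule subsetI)
    fix B assume "B \<in> range (\<lambda>n. {r<..r + real (Suc n)} \<times> {\<omega> \<in> \<Omega>. a \<omega> r q})"
    then obtain n where B: "B = {r<..r + real (Suc n)} \<times> {\<omega> \<in> \<Omega>. a \<omega> r q}" by blast
    have "s \<le> r" "r < r + real (Suc n)" using rq by auto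
    then show "B \<in> sets (predictable_algebra \<Omega> s \<F>)"
      unfolding predictable_algebra_def sets_measure_of[OF gen] B
      using a[OF rq] by (intro sigma_sets.Basic) blast
  qed
  finally show "{z \<in> space (predictable_algebra \<Omega> s \<F>). r < fst z \<and> a (snd z) r q}
      \<in> sets (predictable_algebra \<Omega> s \<F>)" .
qed

section \<open>The claim process restarted at a fixed time\<close>

lemma jump_time_mono:
  assumes "\<And>i. 1 \<le> i \<Longrightarrow> 0 \<le> Y i \<omega>" "m \<le> n"
  shows "jump_time Y m \<omega> \<le> jump_time Y n \<omega>"
  unfolding jump_time_def using assms by (intro sum_mono2) auto

text \<open>
  The set of claim numbers counted is an initial segment, because jump times are nondecreasing; its
  cardinality therefore is its maximum.
\<close>
lemma le_claim_count_iff: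
  assumes nn: "\<And>i. 1 \<le> i \<Longrightarrow> 0 \<le> Y i \<omega>" and fin: "finite {n. 1 \<le> n \<and> jump_time Y n \<omega> \<le> t}" and "1 \<le> n"
  shows "n \<le> claim_count Y t \<omega> \<longleftrightarrow> jump_time Y n \<omega> \<le> t"
proof -
  let ?S = "{n. 1 \<le> n \<and> jump_time Y n \<omega> \<le> t}"
  have down: "m \<in> ?S" if "n \<in> ?S" "1 \<le> m" "m \<le> n" for m n
    using jump_time_mono[of Y \<omega> m n, OF nn] that by auto
  have "?S = {1..card ?S}"
  proof (cases "?S = {}")
    case True
    show ?thesis unfolding True by simp
  next
    case False
    define m where "m = Max ?S"
    have S: "?S = {1..m}" unfolding m_def
    proof (intro set_eqI iffI)
      fix m assume "m \<in> ?S"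
      then show "m \<in> {1..Max ?S}" using Max_ge[OF fin] by simp
    next
      fix m assume "m \<in> {1..Max ?S}"
      then show "m \<in> ?S" using down[OF Max_in[OF fin False], of m] by simp
    qed
    show ?thesis unfolding S by simp
  qed
  then have "n \<in> ?S \<longleftrightarrow> n \<in> {1..card ?S}" by simp
  then show ?thesis using \<open>1 \<le> n\<close> by (simp add: claim_count_def)
qed

context sparre_andersen
begin

abbreviation \<Omega> :: "'a set" where "\<Omega> \<equiv> space M"

lemma claim_count_ge_iff:
  assumes "\<omega> \<in> \<Omega>" "1 \<le> n"
  shows "n \<le> claim_count Y t \<omega> \<longleftrightarrow> jump_time Y n \<omega> \<le> t"
  using assms by (intro le_claim_count_iff Y_nonneg N_finite) auto

lemma claim_count_mono:
  assumes "\<omega> \<in> \<Omega>" "t \<le> t'"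
  shows "claim_count Y t \<omega> \<le> claim_count Y t' \<omega>"
  using claim_count_ge_iff[OF assms(1), of "claim_count Y t \<omega>" t]
    claim_count_ge_iff[OF assms(1), of "claim_count Y t \<omega>" t'] assms(2)
  by (cases "claim_count Y t \<omega> = 0") auto

lemma jump_time_post_wait:
  "1 \<le> n \<Longrightarrow> jump_time (post_wait Y s) n \<omega> = jump_time Y (claim_count Y s \<omega> + n) \<omega> - s"
proof (induction n rule: nat_induct_at_least)
  case (Suc n)
  then show ?case by (simp add: jump_time_def post_wait_def)
qed (simp add: jump_time_def post_wait_def)

lemma claim_count_post_wait:
  assumes \<omega>: "\<omega> \<in> \<Omega>" and "s \<le> t"
  shows "claim_count (post_wait Y s) (t - s) \<omega> = claim_count Y t \<omega> - claim_count Y s \<omega>"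
proof -
  have "{n. 1 \<le> n \<and> jump_time (post_wait Y s) n \<omega> \<le> t - s}
      = {1..claim_count Y t \<omega> - claim_count Y s \<omega>}"
  proof (intro set_eqI)
    fix n
    show "n \<in> {n. 1 \<le> n \<and> jump_time (post_wait Y s) n \<omega> \<le> t - s} \<longleftrightarrow>
        n \<in> {1..claim_count Y t \<omega> - claim_count Y s \<omega>}"
      using claim_count_ge_iff[OF \<omega>, of "claim_count Y s \<omega> + n" t]
      by (cases "1 \<le> n") (auto simp: jump_time_post_wait)
  qed
  then show ?thesis by (simp add: claim_count_def[of "post_wait Y s"])
qed

lemma total_claim_split:
  assumes \<omega>: "\<omega> \<in> \<Omega>" and "s \<le> t"
  shows "total_claim Y U t \<omega> = total_claim Y U s \<omega> + post_total_claim Y U s t \<omega>"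
proof -
  define m where "m = claim_count Y s \<omega>"
  define d where "d = claim_count Y t \<omega> - claim_count Y s \<omega>"
  have N: "claim_count Y t \<omega> = m + d" using claim_count_mono[OF assms] by (simp add: m_def d_def)
  have "(\<Sum>i=1..m + d. U i \<omega>) = (\<Sum>i=1..m. U i \<omega>) + (\<Sum>i=1..d. U (m + i) \<omega>)" for d
    by (induction d) (auto simp: algebra_simps)
  then show ?thesis
    unfolding total_claim_def post_total_claim_def post_claim_def N m_def[symmetric] by simp
qed

lemma clock_before_next_claim:
  assumes "claim_count Y t \<omega> = claim_count Y s \<omega>"
  shows "clock Y t \<omega> = clock Y s \<omega> + (t - s)"
  using assms by (simp add: clock_def)

lemma clock_after_next_claim:
  assumes "\<omega> \<in> \<Omega>" "s \<le> t" "claim_count Y s \<omega> < claim_count Y t \<omega>"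
  shows "clock Y t \<omega> = (t - s) - jump_time (post_wait Y s) (claim_count Y t \<omega> - claim_count Y s \<omega>) \<omega>"
  using assms by (simp add: clock_def jump_time_post_wait)

text \<open>
  No claim occurs between \<open>t\<close> and the first jump time after \<open>t\<close>.
\<close>
lemma claim_count_right_constant:
  assumes \<omega>: "\<omega> \<in> \<Omega>"
  shows "\<forall>\<^sub>F u in at_right t. claim_count Y u \<omega> = claim_count Y t \<omega>"
  unfolding eventually_at_right_field
proof (intro exI[of _ "jump_time Y (claim_count Y t \<omega> + 1) \<omega>"] conjI allI impI)
  show "t < jump_time Y (claim_count Y t \<omega> + 1) \<omega>"
    using claim_count_ge_iff[OF \<omega>, of "claim_count Y t \<omega> + 1" t] by auto
  fix u assume u: "t < u" "u < jump_time Y (claim_count Y t \<omega> + 1) \<omega>"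
  then have "claim_count Y u \<omega> < claim_count Y t \<omega> + 1"
    using claim_count_ge_iff[OF \<omega>, of "claim_count Y t \<omega> + 1" u] by auto
  then show "claim_count Y u \<omega> = claim_count Y t \<omega>" using claim_count_mono[OF \<omega>, of t u] u by simp
qed

definition reserve :: "real \<Rightarrow> real \<Rightarrow> 'a \<Rightarrow> real \<Rightarrow> real" where
  "reserve s x \<omega> t = x + p * (t - s) - post_total_claim Y U s t \<omega>"

lemma reserve_right_continuous:
  assumes \<omega>: "\<omega> \<in> \<Omega>"
  shows "right_continuous_from s (reserve s x \<omega>)"
  unfolding right_continuous_from_def reserve_def
proof (intro allI impI tendsto_intros)
  fix t
  show "((\<lambda>t. post_total_claim Y U s t \<omega>) \<longlongrightarrow> post_total_claim Y U s t \<omega>) (at_right t)"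
    by (rule tendsto_eventually, rule eventually_mono[OF claim_count_right_constant[OF \<omega>]])
      (simp add: post_total_claim_def)
qed

definition post_data :: "real \<Rightarrow> 'a \<Rightarrow> (nat \<Rightarrow> real) \<times> (nat \<Rightarrow> real)" where
  "post_data s = (\<lambda>\<omega>. (\<lambda>k\<in>{1..}. post_wait Y s k \<omega>, \<lambda>k\<in>{1..}. post_claim Y U s k \<omega>))"

abbreviation data_space :: "((nat \<Rightarrow> real) \<times> (nat \<Rightarrow> real)) measure" where
  "data_space \<equiv> PiM {1..} (\<lambda>_. borel) \<Otimes>\<^sub>M PiM {1..} (\<lambda>_. borel)"

definition post_events :: "real \<Rightarrow> 'a measure" where
  "post_events s = vimage_algebra \<Omega> (post_data s) data_space"

lemma space_post_events[simp]: "space (post_events s) = \<Omega>"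
  by (simp add: post_events_def)

lemma post_data_measurable: "post_data s \<in> post_events s \<rightarrow>\<^sub>M data_space"
  unfolding post_events_def
  by (rule measurable_vimage_algebra1) (auto simp: post_data_def space_pair_measure space_PiM)

lemma
  assumes "1 \<le> k"
  shows post_wait_post_events: "post_wait Y s k \<in> borel_measurable (post_events s)"
    and post_claim_post_events: "post_claim Y U s k \<in> borel_measurable (post_events s)"
proof -
  have "(\<lambda>\<omega>. fst (post_data s \<omega>) k) \<in> borel_measurable (post_events s)"
    using assms by (intro measurable_compose[OF measurable_compose[OF post_data_measurable measurable_fst]
        measurable_component_singleton]) auto
  then show "post_wait Y s k \<in> borel_measurable (post_events s)" using assms by (simp add: post_data_def)
  have "(\<lambda>\<omega>. snd (post_data s \<omega>) k) \<in> borel_measurable (post_events s)"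
    using assms by (intro measurable_compose[OF measurable_compose[OF post_data_measurable measurable_snd]
        measurable_component_singleton]) auto
  then show "post_claim Y U s k \<in> borel_measurable (post_events s)" using assms by (simp add: post_data_def)
qed

lemma jump_time_post_events: "jump_time (post_wait Y s) n \<in> borel_measurable (post_events s)"
  unfolding jump_time_def[abs_def] by (intro borel_measurable_sum post_wait_post_events) auto

lemma claim_count_post_events:
  assumes "s \<le> t"
  shows "(\<lambda>\<omega>. claim_count Y t \<omega> - claim_count Y s \<omega>) \<in> post_events s \<rightarrow>\<^sub>M count_space UNIV"
proof -
  note [measurable] = jump_time_post_events
  have "claim_count (post_wait Y s) (t - s) \<in> post_events s \<rightarrow>\<^sub>M count_space UNIV"
    unfolding claim_count_def[abs_def] by measurable
  then show ?thesis
    by (rule measurable_cong[THEN iffD1, rotated]) (use assms claim_count_post_wait in auto)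
qed

lemma post_total_claim_post_events:
  assumes "s \<le> t"
  shows "post_total_claim Y U s t \<in> borel_measurable (post_events s)"
proof -
  have "(\<lambda>\<omega>. \<Sum>i=1..n. post_claim Y U s i \<omega>) \<in> borel_measurable (post_events s)" for n
    by (intro borel_measurable_sum post_claim_post_events) auto
  from measurable_compose_countable[OF this claim_count_post_events[OF assms]]
  show ?thesis unfolding post_total_claim_def[abs_def] .
qed

text \<open>
  The clock is a function of the future of \<open>s\<close> only once a claim has occurred after \<open>s\<close>; the value
  0 before that is a placeholder that carries no information about the past.
\<close>
definition post_clock :: "real \<Rightarrow> real \<Rightarrow> 'a \<Rightarrow> real" where
  "post_clock s t \<omega> = (if claim_count Y t \<omega> - claim_count Y s \<omega> = 0 then 0 else clock Y t \<omega>)"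

lemma post_clock_post_events:
  assumes "s \<le> t"
  shows "post_clock s t \<in> borel_measurable (post_events s)"
proof -
  note [measurable] = jump_time_post_events claim_count_post_events[OF assms]
  have [measurable]: "(\<lambda>\<omega>. jump_time (post_wait Y s) (claim_count Y t \<omega> - claim_count Y s \<omega>) \<omega>)
      \<in> borel_measurable (post_events s)"
    by (rule measurable_compose_countable[OF jump_time_post_events claim_count_post_events[OF assms]])
  have "(\<lambda>\<omega>. if claim_count Y t \<omega> - claim_count Y s \<omega> = 0 then 0
      else (t - s) - jump_time (post_wait Y s) (claim_count Y t \<omega> - claim_count Y s \<omega>) \<omega>)
      \<in> borel_measurable (post_events s)"
    by measurable
  then show ?thesis
    by (rule measurable_cong[THEN iffD1, rotated])
      (auto simp: post_clock_def clock_after_next_claim[OF _ assms])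
qed

abbreviation history :: "real \<Rightarrow> 'a measure" where
  "history t \<equiv> claim_history \<Omega> Y U t"

lemma
  assumes "0 \<le> s" "s \<le> t" "t \<le> r"
  shows claim_count_diff_history: "(\<lambda>\<omega>. claim_count Y t \<omega> - claim_count Y s \<omega>) \<in> history r \<rightarrow>\<^sub>M count_space UNIV"
    and post_total_claim_history: "post_total_claim Y U s t \<in> borel_measurable (history r)"
    and post_clock_history: "post_clock s t \<in> borel_measurable (history r)"
proof -
  have [measurable]: "claim_count Y s \<in> history r \<rightarrow>\<^sub>M count_space UNIV"
    "claim_count Y t \<in> history r \<rightarrow>\<^sub>M count_space UNIV"
    "total_claim Y U s \<in> borel_measurable (history r)" "total_claim Y U t \<in> borel_measurable (history r)"
    "clock Y t \<in> borel_measurable (history r)"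
    using assms by (auto intro!: claim_count_history total_claim_history clock_history)
  show "(\<lambda>\<omega>. claim_count Y t \<omega> - claim_count Y s \<omega>) \<in> history r \<rightarrow>\<^sub>M count_space UNIV"
    by measurable
  show "post_clock s t \<in> borel_measurable (history r)"
    unfolding post_clock_def[abs_def] by measurable
  have "(\<lambda>\<omega>. total_claim Y U t \<omega> - total_claim Y U s \<omega>) \<in> borel_measurable (history r)"
    by measurable
  then show "post_total_claim Y U s t \<in> borel_measurable (history r)"
    by (rule measurable_cong[THEN iffD1, rotated]) (use total_claim_split[OF _ assms(2)] in auto)
qed

text \<open>
  Events between \<open>s\<close> and \<open>r\<close>: those that are known at time \<open>r\<close> and determined by the restarted
  process.
\<close>
definition post_history :: "real \<Rightarrow> real \<Rightarrow> 'a measure" where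
  "post_history s r = sigma \<Omega> (sets (history r) \<inter> sets (post_events s))"

lemma space_post_history[simp]: "space (post_history s r) = \<Omega>"
  unfolding post_history_def using sets.space_closed[of "post_events s"] by (intro space_measure_of) auto

text \<open>
  An intersection of two sigma-algebras is a sigma-algebra.
\<close>
lemma sets_post_history: "sets (post_history s r) = sets (history r) \<inter> sets (post_events s)"
proof -
  have "sets (post_history s r) = sigma_sets \<Omega> (sets (history r) \<inter> sets (post_events s))"
    unfolding post_history_def using sets.space_closed[of "post_events s"] by (intro sets_measure_of) auto
  also have "\<dots> = sets (history r) \<inter> sets (post_events s)"
  proof (intro equalityI Int_greatest)
    show "sigma_sets \<Omega> (sets (history r) \<inter> sets (post_events s)) \<subseteq> sets (history r)"
      using sets.sigma_sets_subset[of "sets (history r) \<inter> sets (post_events s)" "history r"] by simp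
    show "sigma_sets \<Omega> (sets (history r) \<inter> sets (post_events s)) \<subseteq> sets (post_events s)"
      using sets.sigma_sets_subset[of "sets (history r) \<inter> sets (post_events s)" "post_events s"] by simp
  qed auto
  finally show ?thesis .
qed

lemma measurable_post_history:
  assumes "g \<in> history r \<rightarrow>\<^sub>M B" "g \<in> post_events s \<rightarrow>\<^sub>M B"
  shows "g \<in> post_history s r \<rightarrow>\<^sub>M B"
  using measurable_space[OF assms(1)] measurable_sets[OF assms(1)] measurable_sets[OF assms(2)]
  by (intro measurableI) (auto simp: sets_post_history)

text \<open>
  Each of the three processes generating the filtration is, at a time after \<open>s\<close>, a function of its
  value at \<open>s\<close> and of quantities of the restarted process.  Hence every event known at \<open>r\<close> is the
  trace on the diagonal of an event in which past and future may vary separately.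
\<close>
lemma history_split:
  assumes "0 \<le> s" "s \<le> r" and A: "A \<in> sets (history r)"
  shows "\<exists>B\<in>sets (history s \<Otimes>\<^sub>M post_history s r). \<forall>\<omega>\<in>\<Omega>. \<omega> \<in> A \<longleftrightarrow> (\<omega>, \<omega>) \<in> B"
proof -
  define V where "V = vimage_algebra \<Omega> (\<lambda>\<omega>. (\<omega>, \<omega>)) (history s \<Otimes>\<^sub>M post_history s r)"
  have V: "space V = \<Omega>" by (simp add: V_def)
  have diag: "(\<lambda>\<omega>. (\<omega>, \<omega>)) \<in> V \<rightarrow>\<^sub>M history s \<Otimes>\<^sub>M post_history s r"
    unfolding V_def by (rule measurable_vimage_algebra1) (auto simp: space_pair_measure)
  have H: "(\<lambda>\<omega>. \<omega>) \<in> V \<rightarrow>\<^sub>M history s" and D: "(\<lambda>\<omega>. \<omega>) \<in> V \<rightarrow>\<^sub>M post_history s r"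
    using measurable_compose[OF diag measurable_fst] measurable_compose[OF diag measurable_snd] by simp_all
  have N: "claim_count Y t \<in> V \<rightarrow>\<^sub>M count_space UNIV" and Q: "total_claim Y U t \<in> borel_measurable V"
    and W: "clock Y t \<in> borel_measurable V" if "0 \<le> t" "t \<le> r" for t
  proof -
    have "claim_count Y t \<in> V \<rightarrow>\<^sub>M count_space UNIV \<and> total_claim Y U t \<in> borel_measurable V
        \<and> clock Y t \<in> borel_measurable V"
    proof (cases "t \<le> s")
      case True
      show ?thesis
        using measurable_compose[OF H claim_count_history[OF that(1) True]]
          measurable_compose[OF H total_claim_history[OF that(1) True]]
          measurable_compose[OF H clock_history[OF that(1) True]] by simp
    next
      case False
      then have st: "s \<le> t" by simp
      have [measurable]: "claim_count Y s \<in> V \<rightarrow>\<^sub>M count_space UNIV" "total_claim Y U s \<in> borel_measurable V"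
        "clock Y s \<in> borel_measurable V"
        using measurable_compose[OF H claim_count_history[OF assms(1) order_refl]]
          measurable_compose[OF H total_claim_history[OF assms(1) order_refl]]
          measurable_compose[OF H clock_history[OF assms(1) order_refl]] by simp_all
      have [measurable]: "(\<lambda>\<omega>. claim_count Y t \<omega> - claim_count Y s \<omega>) \<in> V \<rightarrow>\<^sub>M count_space UNIV"
        "post_total_claim Y U s t \<in> borel_measurable V" "post_clock s t \<in> borel_measurable V"
        using measurable_compose[OF D measurable_post_history[OF
              claim_count_diff_history[OF assms(1) st that(2)] claim_count_post_events[OF st]]]
          measurable_compose[OF D measurable_post_history[OF
              post_total_claim_history[OF assms(1) st that(2)] post_total_claim_post_events[OF st]]]
          measurable_compose[OF D measurable_post_history[OF
              post_clock_history[OF assms(1) st that(2)] post_clock_post_events[OF st]]]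
        by simp_all
      have "(\<lambda>\<omega>. claim_count Y s \<omega> + (claim_count Y t \<omega> - claim_count Y s \<omega>)) \<in> V \<rightarrow>\<^sub>M count_space UNIV"
        by measurable
      then have 1: "claim_count Y t \<in> V \<rightarrow>\<^sub>M count_space UNIV"
        by (rule measurable_cong[THEN iffD1, rotated]) (use claim_count_mono[OF _ st] V in auto)
      have "(\<lambda>\<omega>. total_claim Y U s \<omega> + post_total_claim Y U s t \<omega>) \<in> borel_measurable V"
        by measurable
      then have 2: "total_claim Y U t \<in> borel_measurable V"
        by (rule measurable_cong[THEN iffD1, rotated]) (use total_claim_split[OF _ st] V in auto)
      have "(\<lambda>\<omega>. if claim_count Y t \<omega> - claim_count Y s \<omega> = 0 then clock Y s \<omega> + (t - s) else post_clock s t \<omega>)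
          \<in> borel_measurable V"
        by measurable
      then have 3: "clock Y t \<in> borel_measurable V"
      proof (rule measurable_cong[THEN iffD1, rotated])
        fix \<omega> assume "\<omega> \<in> space V"
        then have "claim_count Y s \<omega> \<le> claim_count Y t \<omega>" using claim_count_mono[OF _ st] V by auto
        then show "(if claim_count Y t \<omega> - claim_count Y s \<omega> = 0 then clock Y s \<omega> + (t - s) else post_clock s t \<omega>)
            = clock Y t \<omega>"
          using clock_before_next_claim[of t \<omega> s] by (simp add: post_clock_def)
      qed
      show ?thesis using 1 2 3 by simp
    qed
    then show "claim_count Y t \<in> V \<rightarrow>\<^sub>M count_space UNIV" "total_claim Y U t \<in> borel_measurable V"
      "clock Y t \<in> borel_measurable V" by simp_all
  qed
  have "sets (history r) \<subseteq> sets V" by (rule sets_claim_history_least) (use V N Q W in auto)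
  then have "A \<in> sets V" using A by blast
  then obtain B where "B \<in> sets (history s \<Otimes>\<^sub>M post_history s r)" "A = (\<lambda>\<omega>. (\<omega>, \<omega>)) -` B \<inter> \<Omega>"
    unfolding V_def by (subst (asm) sets_vimage_algebra2) (auto simp: space_pair_measure)
  then show ?thesis by (intro bexI[of _ B]) auto
qed

end

section \<open>Dependence of the law of the future on the clock\<close>

context conditioned_sparre_andersen
begin

text \<open>
  Continuing \<open>lam\<close> constantly to negative times makes its antiderivative differentiable on both
  sides at 0, which is the reason for starting the next integral at \<open>-1\<close>.
\<close>
definition hazard :: "real \<Rightarrow> real" where
  "hazard t = lam (max 0 t)"

definition cum_hazard :: "real \<Rightarrow> real" where
  "cum_hazard t = integral {-1..t} hazard"

lemma hazard_continuous: "continuous_on A hazard"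
proof -
  have "continuous_on UNIV (\<lambda>t. lam (max 0 t))"
    by (rule continuous_on_compose2[OF lam_cont]) (intro continuous_intros, auto)
  then show ?thesis unfolding hazard_def[abs_def] using continuous_on_subset by blast
qed

lemma hazard_nonneg: "0 \<le> hazard t"
  using lam_nonneg by (simp add: hazard_def)

lemma hazard_integrable: "hazard integrable_on {a..b}"
  by (rule integrable_continuous_real[OF hazard_continuous])

lemma cum_hazard_mono: "x \<le> y \<Longrightarrow> cum_hazard x \<le> cum_hazard y"
  unfolding cum_hazard_def
  by (intro integral_subset_le hazard_integrable) (auto simp: hazard_nonneg)

lemma cum_hazard_deriv:
  assumes "-1 < t"
  shows "(cum_hazard has_real_derivative hazard t) (at t)"
proof -
  have "((\<lambda>t. integral {-1..t} hazard) has_real_derivative hazard t) (at t within {-1..t + 1})"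
    by (rule integral_has_real_derivative[OF hazard_continuous]) (use assms in auto)
  moreover have "at t within {-1..t + 1} = at t"
    by (rule at_within_interior) (use assms in auto)
  ultimately show ?thesis unfolding cum_hazard_def[abs_def] by simp
qed

lemma integral_lam:
  assumes "0 \<le> a" "a \<le> b"
  shows "integral {a..b} lam = cum_hazard b - cum_hazard a"
proof -
  have "integral {a..b} lam = integral {a..b} hazard"
    by (intro integral_cong) (use assms in \<open>auto simp: hazard_def\<close>)
  moreover have "cum_hazard a + integral {a..b} hazard = cum_hazard b"
    unfolding cum_hazard_def using assms
    by (intro Henstock_Kurzweil_Integration.integral_combine hazard_integrable) auto
  ultimately show ?thesis by simp
qed

lemma prob_space_kernel:
  assumes "s \<in> {0..T}" "w \<in> {0..s}"
  shows "prob_space (K s w)" "sets (K s w) = sets M" "space (K s w) = space M"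
proof -
  have "K s w \<in> space (prob_algebra M)"
    using measurable_space[OF K_kernel[OF assms(1)], of w] assms(2) by (simp add: space_restrict_space)
  then show "prob_space (K s w)" "sets (K s w) = sets M" by (auto simp: space_prob_algebra)
  then show "space (K s w) = space M" by (intro sets_eq_imp_space_eq)
qed

lemma post_wait_random:
  assumes "s \<in> {0..T}" "w \<in> {0..s}" "1 \<le> k"
  shows "post_wait Y s k \<in> borel_measurable (K s w)"
proof -
  interpret P: prob_space "K s w" by (rule prob_space_kernel[OF assms(1,2)])
  show ?thesis using K_wait_indep[OF assms(1,2)] assms(3) unfolding P.indep_vars_def by auto
qed

lemma post_claim_random:
  assumes "s \<in> {0..T}" "w \<in> {0..s}" "1 \<le> k"
  shows "post_claim Y U s k \<in> borel_measurable (K s w)"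
proof -
  interpret P: prob_space "K s w" by (rule prob_space_kernel[OF assms(1,2)])
  show ?thesis using K_claim_indep[OF assms(1,2)] assms(3) unfolding P.indep_vars_def by auto
qed

definition survival :: "real \<Rightarrow> real \<Rightarrow> real" where
  "survival w x = exp (cum_hazard w - cum_hazard (w + x))"

definition wait_density :: "real \<Rightarrow> real \<Rightarrow> real" where
  "wait_density w x = (if x < 0 then 0 else hazard (w + x) * survival w x)"

lemma cum_hazard_measurable[measurable]: "cum_hazard \<in> borel_measurable borel"
  by (rule borel_measurable_mono) (auto simp: mono_def cum_hazard_mono)

lemma hazard_measurable[measurable]: "hazard \<in> borel_measurable borel"
  by (rule borel_measurable_continuous_onI[OF hazard_continuous])

lemma wait_density_measurable[measurable]: "wait_density w \<in> borel_measurable borel"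
  unfolding wait_density_def[abs_def] survival_def by measurable

lemma wait_density_nonneg: "0 \<le> wait_density w x"
  by (simp add: wait_density_def survival_def hazard_nonneg)

text \<open>
  A waiting time that has lasted \<open>w\<close> still ends almost surely: up to a constant factor depending on
  \<open>w\<close>, the survival function is a shift of \<open>1 - F\<close>.
\<close>
lemma survival_tendsto_0: "((\<lambda>x. survival w x) \<longlongrightarrow> 0) at_top"
proof -
  have rd: "real_distribution (distr M borel (Y 1))"
    using Y_random[of 1] by (intro real_distribution_distr) simp
  have "(F \<longlongrightarrow> 1) at_top"
    using real_distribution.cdf_lim_at_top_prob[OF rd] Y_cdf[of 1] by simp
  then have "((\<lambda>t. 1 - F t) \<longlongrightarrow> 1 - 1) at_top" by (intro tendsto_intros)
  then have "((\<lambda>t. 1 - F t) \<longlongrightarrow> 0) at_top" by simp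
  moreover have "\<forall>\<^sub>F t in at_top. 1 - F t = exp (cum_hazard 0 - cum_hazard t)"
    using eventually_ge_at_top[of 0] by eventually_elim (simp add: F_lam integral_lam)
  ultimately have lim: "((\<lambda>t. exp (cum_hazard 0 - cum_hazard t)) \<longlongrightarrow> 0) at_top"
    by (rule Lim_transform_eventually)
  have "filterlim (\<lambda>x. w + x) at_top at_top"
    by (rule filterlim_tendsto_add_at_top[OF tendsto_const filterlim_ident])
  from filterlim_compose[OF lim this]
  have "((\<lambda>x. exp (cum_hazard w - cum_hazard 0) * exp (cum_hazard 0 - cum_hazard (w + x)))
      \<longlongrightarrow> exp (cum_hazard w - cum_hazard 0) * 0) at_top" by (intro tendsto_intros)
  then show ?thesis by (simp add: survival_def exp_add[symmetric])
qed

lemma nn_integral_wait_density: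
  assumes "0 \<le> w" "0 \<le> a"
  shows "(\<integral>\<^sup>+x\<in>{a..}. ennreal (wait_density w x) \<partial>lborel) = ennreal (survival w a)"
proof -
  have "(\<integral>\<^sup>+x\<in>{a..}. ennreal (wait_density w x) \<partial>lborel) = ennreal (0 - - survival w a)"
  proof (rule nn_integral_FTC_atLeast)
    show "((\<lambda>x. - survival w x) \<longlongrightarrow> 0) at_top"
      using tendsto_minus[OF survival_tendsto_0[of w]] by simp
    fix x assume x: "a \<le> x"
    have "((\<lambda>x. cum_hazard (w + x)) has_real_derivative hazard (w + x) * 1) (at x)"
      by (rule DERIV_chain2[OF cum_hazard_deriv]) (use assms x in \<open>auto intro!: derivative_eq_intros\<close>)
    then show "((\<lambda>x. - survival w x) has_real_derivative wait_density w x) (at x)"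
      unfolding survival_def wait_density_def using assms x by (auto intro!: derivative_eq_intros)
  qed (auto simp: wait_density_nonneg)
  then show ?thesis by simp
qed

lemma first_wait_law:
  assumes "s \<in> {0..T}" "w \<in> {0..s}"
  shows "distr (K s w) borel (post_wait Y s 1) = density lborel (\<lambda>x. ennreal (wait_density w x))"
    (is "?D = ?N")
proof (rule measure_eqI_lessThan)
  interpret P: prob_space "K s w" by (rule prob_space_kernel[OF assms])
  have rv[measurable]: "post_wait Y s 1 \<in> borel_measurable (K s w)"
    by (rule post_wait_random) (use assms in auto)
  interpret D: prob_space ?D by (rule P.prob_space_distr[OF rv])
  have w: "0 \<le> w" using assms by simp
  have D: "emeasure ?D {x<..} = ennreal (survival w x)" if "0 \<le> x" for x
  proof -
    have "emeasure ?D {x<..} = ennreal (measure (K s w) {\<omega> \<in> space M. x < post_wait Y s 1 \<omega>})"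
      by (subst emeasure_distr[OF rv]) (auto simp: P.emeasure_eq_measure prob_space_kernel[OF assms]
          intro!: arg_cong[where f="measure _"])
    also have "\<dots> = ennreal (survival w x)"
      using K_first[OF assms that] integral_lam[of w "w + x"] w that by (simp add: survival_def)
    finally show ?thesis .
  qed
  have N: "emeasure ?N {x<..} = ennreal (survival w x)" if "0 \<le> x" for x
  proof -
    have "emeasure ?N {x<..} = (\<integral>\<^sup>+y\<in>{x<..}. ennreal (wait_density w y) \<partial>lborel)"
      by (rule emeasure_density) simp_all
    also have "\<dots> = (\<integral>\<^sup>+y\<in>{x..}. ennreal (wait_density w y) \<partial>lborel)"
      by (intro nn_integral_cong_AE) (use AE_lborel_singleton[of x] in \<open>auto elim: AE_mp simp: indicator_def\<close>)
    finally show ?thesis using nn_integral_wait_density[OF w that] by simp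
  qed
  show "emeasure ?D {x<..} = emeasure ?N {x<..}" for x
  proof (cases "0 \<le> x")
    case True
    then show ?thesis using D N by simp
  next
    case False
    have one: "survival w 0 = 1" by (simp add: survival_def)
    have "emeasure ?D {0<..} \<le> emeasure ?D {x<..}" using False by (intro emeasure_mono) auto
    then have "1 \<le> emeasure ?D {x<..}" using D[of 0] one by simp
    with D.emeasure_le_1[of "{x<..}"] have "emeasure ?D {x<..} = 1" by (rule antisym)
    moreover have "emeasure ?N {x<..} = 1"
    proof -
      have "emeasure ?N {x<..} = (\<integral>\<^sup>+y\<in>{x<..}. ennreal (wait_density w y) \<partial>lborel)"
        by (rule emeasure_density) simp_all
      also have "\<dots> = (\<integral>\<^sup>+y\<in>{0..}. ennreal (wait_density w y) \<partial>lborel)"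
        using False by (intro nn_integral_cong) (simp add: indicator_def wait_density_def)
      also have "\<dots> = 1" using nn_integral_wait_density[OF w, of 0] one by simp
      finally show ?thesis .
    qed
    ultimately show ?thesis by simp
  qed
  show "emeasure ?D {x<..} < \<infinity>" for x using D.emeasure_finite[of "{x<..}"] by (simp add: less_top)
qed simp_all

text \<open>
  The integral of the positive part of the difference of the two densities, which is the total
  variation distance of the two laws; \<open>ennreal\<close> maps negative numbers to 0.
\<close>
definition wait_excess :: "real \<Rightarrow> real \<Rightarrow> ennreal" where
  "wait_excess w w' = (\<integral>\<^sup>+x. ennreal (wait_density w x - wait_density w' x) \<partial>lborel)"

text \<open>
  The densities are jointly continuous in \<open>w\<close> and \<open>x\<close>, hence uniformly continuous on the compact set
  \<open>[0, T] \<times> [0, A]\<close>.  Beyond \<open>A\<close> the positive part is bounded by the density for \<open>w\<close>, whose tail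
  is small uniformly in \<open>w\<close> because the cumulative hazard is nondecreasing and unbounded.
\<close>
lemma wait_excess_small:
  assumes "0 < \<epsilon>"
  shows "\<exists>\<delta>>0. \<forall>w\<in>{0..T}. \<forall>w'\<in>{0..T}. \<bar>w - w'\<bar> < \<delta> \<longrightarrow> wait_excess w w' \<le> ennreal \<epsilon>"
proof -
  have "\<forall>\<^sub>F A in at_top. survival T A < \<epsilon> / 2"
    using order_tendstoD(2)[OF survival_tendsto_0[of T], of "\<epsilon> / 2"] assms by simp
  then obtain B where B: "\<And>A. B \<le> A \<Longrightarrow> survival T A < \<epsilon> / 2" by (auto simp: eventually_at_top_linorder)
  \<comment> \<open>The shift by \<open>T\<close> absorbs the clock: the tail beyond \<open>A\<close> for \<open>w\<close> is at most the tail beyond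
    \<open>A - T\<close> for \<open>T\<close>.\<close>
  define A where "A = max 1 B + T"
  have A: "1 \<le> A" "survival T (A - T) < \<epsilon> / 2" using pos(1) B[of "A - T"] by (auto simp: A_def)
  let ?g = "\<lambda>z. hazard (fst z + snd z) * exp (cum_hazard (fst z) - cum_hazard (fst z + snd z))"
  have H: "continuous_on {0..} cum_hazard"
    by (intro continuous_at_imp_continuous_on ballI DERIV_isCont[OF cum_hazard_deriv]) auto
  have "uniformly_continuous_on ({0..T} \<times> {0..A}) ?g"
  proof (rule compact_uniformly_continuous)
    show "continuous_on ({0..T} \<times> {0..A}) ?g"
      by (intro continuous_intros continuous_on_compose2[OF H] continuous_on_compose2[OF hazard_continuous[of UNIV]]) auto
  qed (intro compact_Times compact_Icc)
  moreover have "0 < \<epsilon> / (2 * A)" using assms A(1) by simp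
  ultimately obtain \<delta> where \<delta>: "0 < \<delta>" "\<And>z z'. z \<in> {0..T} \<times> {0..A} \<Longrightarrow> z' \<in> {0..T} \<times> {0..A} \<Longrightarrow>
      dist z' z < \<delta> \<Longrightarrow> dist (?g z') (?g z) < \<epsilon> / (2 * A)"
    unfolding uniformly_continuous_on_def by blast
  show ?thesis
  proof (intro exI[of _ \<delta>] conjI ballI impI \<delta>(1))
    fix w w' assume w: "w \<in> {0..T}" "w' \<in> {0..T}" "\<bar>w - w'\<bar> < \<delta>"
    have core: "wait_density w x - wait_density w' x \<le> \<epsilon> / (2 * A)" if "x \<in> {0..A}" for x
    proof -
      have "dist (?g (w, x)) (?g (w', x)) < \<epsilon> / (2 * A)"
        using w that by (intro \<delta>(2)) (auto simp: dist_Pair_Pair dist_real_def)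
      then show ?thesis using that by (simp add: wait_density_def survival_def dist_real_def)
    qed
    have "wait_excess w w' \<le> (\<integral>\<^sup>+x. ennreal (\<epsilon> / (2 * A)) * indicator {0..A} x
        + ennreal (wait_density w x) * indicator {A..} x \<partial>lborel)"
      unfolding wait_excess_def
    proof (rule nn_integral_mono)
      fix x
      consider "x < 0" | "x \<in> {0..A}" | "A < x" by fastforce
      then show "ennreal (wait_density w x - wait_density w' x)
          \<le> ennreal (\<epsilon> / (2 * A)) * indicator {0..A} x + ennreal (wait_density w x) * indicator {A..} x"
      proof cases
        case 1
        then show ?thesis by (simp add: wait_density_def)
      next
        case 2
        then have "ennreal (wait_density w x - wait_density w' x) \<le> ennreal (\<epsilon> / (2 * A))"
          using core by (intro ennreal_leI)
        then show ?thesis using 2 by (simp add: add_increasing2)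
      next
        case 3
        then show ?thesis using wait_density_nonneg[of w' x] A(1) by (auto intro!: ennreal_leI)
      qed
    qed
    also have "\<dots> = ennreal (\<epsilon> / (2 * A)) * ennreal A + ennreal (survival w A)"
    proof -
      have "0 \<le> w" "0 \<le> A" using w A by auto
      from nn_integral_wait_density[OF this] show ?thesis using A(1)
        by (subst nn_integral_add) (auto simp: nn_integral_cmult)
    qed
    also have "\<dots> \<le> ennreal (\<epsilon> / 2) + ennreal (\<epsilon> / 2)"
    proof (intro add_mono)
      show "ennreal (\<epsilon> / (2 * A)) * ennreal A \<le> ennreal (\<epsilon> / 2)"
        using A(1) assms by (simp add: ennreal_mult[symmetric])
      have "survival w A \<le> survival T (A - T)"
        unfolding survival_def using w cum_hazard_mono[of w T] cum_hazard_mono[of A "w + A"] by simp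
      then show "ennreal (survival w A) \<le> ennreal (\<epsilon> / 2)" using A(2) by (intro ennreal_leI) simp
    qed
    also have "\<dots> = ennreal \<epsilon>" using assms by (simp flip: ennreal_plus)
    finally show "wait_excess w w' \<le> ennreal \<epsilon>" .
  qed
qed

definition wait_laws :: "real \<Rightarrow> nat \<Rightarrow> real measure" where
  "wait_laws w k = (if k = 1 then density lborel (\<lambda>x. ennreal (wait_density w x)) else distr M borel (Y 1))"

definition claims_law :: "(nat \<Rightarrow> real) measure" where
  "claims_law = PiM {1..} (\<lambda>_. distr M borel (U 1))"

lemma sets_wait_laws[simp]: "sets (wait_laws w k) = sets borel"
  by (simp add: wait_laws_def)

text \<open>
  That the density of the first law integrates to 1 is read off from its realisation as the law of a
  waiting time under \<open>K T w\<close>.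
\<close>
lemma prob_space_wait_laws:
  assumes "w \<in> {0..T}"
  shows "prob_space (wait_laws w k)"
proof (cases "k = 1")
  case True
  have T: "T \<in> {0..T}" using pos by simp
  interpret P: prob_space "K T w" by (rule prob_space_kernel[OF T assms])
  show ?thesis
    using P.prob_space_distr[OF post_wait_random[OF T assms order_refl]] True
    by (simp add: first_wait_law[OF T assms, unfolded One_nat_def] wait_laws_def)
next
  case False
  then show ?thesis using prob_space_distr[OF Y_random[of 1]] by (simp add: wait_laws_def)
qed

lemma prob_space_claims_law: "prob_space claims_law"
  unfolding claims_law_def
  by (rule prob_space_PiM) (use prob_space_distr[OF U_random[of 1]] in simp)

lemma sets_claims_law[measurable_cong]: "sets claims_law = sets (PiM {1..} (\<lambda>_. borel))"
  unfolding claims_law_def by (rule sets_PiM_cong) auto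

lemma sets_PiM_wait_laws[measurable_cong]: "sets (PiM I (wait_laws w)) = sets (PiM I (\<lambda>_. borel))"
  by (rule sets_PiM_cong) auto

lemma post_data_law:
  assumes "s \<in> {0..T}" "w \<in> {0..s}"
  shows "distr (K s w) data_space (post_data s) = PiM {1..} (wait_laws w) \<Otimes>\<^sub>M claims_law"
proof -
  interpret P: prob_space "K s w" by (rule prob_space_kernel[OF assms])
  note pw = post_wait_random[OF assms] and pc = post_claim_random[OF assms]
  have waits: "distr (K s w) (PiM {1..} (\<lambda>_. borel)) (\<lambda>\<omega>. \<lambda>k\<in>{1..}. post_wait Y s k \<omega>) = PiM {1..} (wait_laws w)"
  proof -
    have "distr (K s w) borel (post_wait Y s k) = wait_laws w k" if "1 \<le> k" for k
    proof (cases "k = 1")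
      case True
      then show ?thesis using first_wait_law[OF assms] by (simp add: wait_laws_def)
    next
      case False
      then have "k \<ge> 2" using that by simp
      have "distr (K s w) borel (post_wait Y s k) = distr M borel (Y 1)"
        by (rule cdf_unique) (use K_later[OF assms \<open>k \<ge> 2\<close>] Y_cdf[of 1] Y_random[of 1] pw[OF that] in
          \<open>auto intro!: P.real_distribution_distr real_distribution_distr\<close>)
      then show ?thesis using False by (simp add: wait_laws_def)
    qed
    then show ?thesis
      using P.indep_vars_iff_distr_eq_PiM'[where I="{1..}" and M'="\<lambda>_. borel" and X="post_wait Y s"]
        K_wait_indep[OF assms] pw
      by (auto intro!: PiM_cong)
  qed
  have claims: "distr (K s w) (PiM {1..} (\<lambda>_. borel)) (\<lambda>\<omega>. \<lambda>k\<in>{1..}. post_claim Y U s k \<omega>) = claims_law"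
  proof -
    have "distr (K s w) borel (post_claim Y U s k) = distr M borel (U 1)" if "1 \<le> k" for k
      by (rule cdf_unique) (use K_claim[OF assms that] U_cdf[of 1] U_random[of 1] pc[OF that] in
          \<open>auto intro!: P.real_distribution_distr real_distribution_distr\<close>)
    then show ?thesis
      using P.indep_vars_iff_distr_eq_PiM'[where I="{1..}" and M'="\<lambda>_. borel" and X="post_claim Y U s"]
        K_claim_indep[OF assms] pc
      by (auto intro!: PiM_cong simp: claims_law_def)
  qed
  show ?thesis
    using K_wait_claim_indep[OF assms] unfolding P.indep_var_distribution_eq waits claims post_data_def by simp
qed

text \<open>
  The two product measures differ in their first factor only.  Integrating over that factor first
  reduces the claim to a comparison of two densities on the line, for a function bounded by \<open>C\<close>.
\<close>
lemma wait_laws_compare: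
  assumes w: "w \<in> {0..T}" "w' \<in> {0..T}"
    and \<Phi>[measurable]: "\<Phi> \<in> borel_measurable (PiM {1..} (\<lambda>_. borel))" and le: "\<And>v. \<Phi> v \<le> C"
  shows "(\<integral>\<^sup>+v. \<Phi> v \<partial>PiM {1..} (wait_laws w))
    \<le> (\<integral>\<^sup>+v. \<Phi> v \<partial>PiM {1..} (wait_laws w')) + C * wait_excess w w'"
proof -
  define later where "later = PiM {2..} (\<lambda>_::nat. distr M borel (Y 1))"
  have later_sets[measurable_cong]: "sets later = sets (PiM {2..} (\<lambda>_. borel))"
    unfolding later_def by (rule sets_PiM_cong) auto
  interpret L: prob_space later
    unfolding later_def by (rule prob_space_PiM) (use prob_space_distr[OF Y_random[of 1]] in simp)
  define \<Psi> where "\<Psi> x X = \<Phi> (X(1 := x))" for x :: real and X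
  have upd: "(\<lambda>z. (snd z)(1 := fst z)) \<in> (borel :: real measure) \<Otimes>\<^sub>M PiM {2..} (\<lambda>_::nat. borel :: real measure)
      \<rightarrow>\<^sub>M PiM {1..} (\<lambda>_. borel :: real measure)"
    by (rule measurable_fun_upd[where J="{2..}"]) auto
  have \<Psi>: "(\<lambda>(x, X). \<Psi> x X) \<in> borel_measurable (borel \<Otimes>\<^sub>M later)"
    using measurable_compose[OF upd \<Phi>]
    by (simp add: \<Psi>_def case_prod_beta' cong: measurable_cong_sets)
  have \<Psi>1[measurable]: "(\<lambda>x. \<Psi> x X) \<in> borel_measurable borel" if "X \<in> space later" for X
    using measurable_compose[OF measurable_Pair2'[OF that] \<Psi>] by simp
  have int: "(\<integral>\<^sup>+v. \<Phi> v \<partial>PiM {1..} (wait_laws u)) =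
      (\<integral>\<^sup>+X. \<integral>\<^sup>+x. ennreal (wait_density u x) * \<Psi> x X \<partial>lborel \<partial>later)" if u: "u \<in> {0..T}" for u
  proof -
    have I: "insert 1 {2..} = {1::nat..}" by auto
    interpret N: prob_space "wait_laws u 1" by (rule prob_space_wait_laws[OF u])
    interpret NL: pair_sigma_finite "wait_laws u 1" later by standard
    have sN: "sets (wait_laws u 1 \<Otimes>\<^sub>M later) = sets (borel \<Otimes>\<^sub>M later)"
      by (intro sets_pair_measure_cong) auto
    have sN2: "sets (wait_laws u 1 \<Otimes>\<^sub>M later) = sets (borel \<Otimes>\<^sub>M PiM {2..} (\<lambda>_. borel))"
      by (intro sets_pair_measure_cong later_sets) auto
    have later: "PiM {2..} (wait_laws u) = later"
      unfolding later_def by (rule PiM_cong) (auto simp: wait_laws_def)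
    have "PiM {1..} (wait_laws u) = distr (wait_laws u 1 \<Otimes>\<^sub>M later) (PiM {1..} (wait_laws u)) (\<lambda>(x, X). X(1 := x))"
      using distr_pair_PiM_eq_PiM[of "{2..}" "wait_laws u" 1] prob_space_wait_laws[OF u] unfolding I later by simp
    also have "\<dots> = distr (wait_laws u 1 \<Otimes>\<^sub>M later) (PiM {1..} (\<lambda>_. borel)) (\<lambda>z. (snd z)(1 := fst z))"
      by (rule distr_cong) (auto simp: sets_PiM_wait_laws)
    finally have "(\<integral>\<^sup>+v. \<Phi> v \<partial>PiM {1..} (wait_laws u))
        = (\<integral>\<^sup>+v. \<Phi> v \<partial>distr (wait_laws u 1 \<Otimes>\<^sub>M later) (PiM {1..} (\<lambda>_. borel)) (\<lambda>z. (snd z)(1 := fst z)))" by simp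
    also have "\<dots> = (\<integral>\<^sup>+z. \<Phi> ((snd z)(1 := fst z)) \<partial>(wait_laws u 1 \<Otimes>\<^sub>M later))"
    proof (rule nn_integral_distr)
      show "(\<lambda>z. (snd z)(1 := fst z)) \<in> wait_laws u 1 \<Otimes>\<^sub>M later \<rightarrow>\<^sub>M PiM {1..} (\<lambda>_. borel)"
        unfolding measurable_cong_sets[OF sN2 refl] by (rule upd)
    qed (use \<Phi> in simp)
    also have "\<dots> = (\<integral>\<^sup>+z. (\<lambda>(x, X). \<Psi> x X) z \<partial>(wait_laws u 1 \<Otimes>\<^sub>M later))"
      by (simp add: case_prod_beta' \<Psi>_def)
    also have "\<dots> = (\<integral>\<^sup>+X. \<integral>\<^sup>+x. \<Psi> x X \<partial>wait_laws u 1 \<partial>later)"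
    proof -
      have "(\<lambda>(x, X). \<Psi> x X) \<in> borel_measurable (wait_laws u 1 \<Otimes>\<^sub>M later)"
        unfolding measurable_cong_sets[OF sN refl] by (rule \<Psi>)
      from NL.nn_integral_snd[OF this] show ?thesis by simp
    qed
    also have "\<dots> = (\<integral>\<^sup>+X. \<integral>\<^sup>+x. ennreal (wait_density u x) * \<Psi> x X \<partial>lborel \<partial>later)"
    proof (intro nn_integral_cong)
      fix X assume X: "X \<in> space later"
      show "(\<integral>\<^sup>+x. \<Psi> x X \<partial>wait_laws u 1) = (\<integral>\<^sup>+x. ennreal (wait_density u x) * \<Psi> x X \<partial>lborel)"
        unfolding wait_laws_def using \<Psi>1[OF X] by (simp add: nn_integral_density)
    qed
    finally show ?thesis .
  qed
  have "(\<integral>\<^sup>+x. ennreal (wait_density w x) * \<Psi> x X \<partial>lborel)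
      \<le> (\<integral>\<^sup>+x. ennreal (wait_density w' x) * \<Psi> x X \<partial>lborel) + C * wait_excess w w'"
    if "X \<in> space later" for X
  proof -
    note \<Psi>1[OF that, measurable]
    have "(\<integral>\<^sup>+x. ennreal (wait_density w x) * \<Psi> x X \<partial>lborel)
        \<le> (\<integral>\<^sup>+x. ennreal (wait_density w' x) * \<Psi> x X
            + C * ennreal (wait_density w x - wait_density w' x) \<partial>lborel)"
    proof (rule nn_integral_mono)
      fix x
      have "ennreal (wait_density w x) \<le> ennreal (wait_density w' x) + ennreal (wait_density w x - wait_density w' x)"
        using wait_density_nonneg[of w x] wait_density_nonneg[of w' x]
        by (cases "wait_density w' x \<le> wait_density w x")
          (auto simp flip: ennreal_plus simp: ennreal_neg intro!: ennreal_leI)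
      then have "ennreal (wait_density w x) * \<Psi> x X
          \<le> (ennreal (wait_density w' x) + ennreal (wait_density w x - wait_density w' x)) * \<Psi> x X"
        by (rule mult_right_mono) simp
      also have "\<dots> \<le> ennreal (wait_density w' x) * \<Psi> x X + C * ennreal (wait_density w x - wait_density w' x)"
        unfolding distrib_right mult.commute[of C] \<Psi>_def
        by (intro add_left_mono mult_left_mono le) simp
      finally show "ennreal (wait_density w x) * \<Psi> x X
        \<le> ennreal (wait_density w' x) * \<Psi> x X + C * ennreal (wait_density w x - wait_density w' x)" .
    qed
    also have "\<dots> = (\<integral>\<^sup>+x. ennreal (wait_density w' x) * \<Psi> x X \<partial>lborel) + C * wait_excess w w'"
      unfolding wait_excess_def by (subst nn_integral_add) (auto simp: nn_integral_cmult)
    finally show ?thesis .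
  qed
  then have "(\<integral>\<^sup>+v. \<Phi> v \<partial>PiM {1..} (wait_laws w))
      \<le> (\<integral>\<^sup>+X. (\<integral>\<^sup>+x. ennreal (wait_density w' x) * \<Psi> x X \<partial>lborel) + C * wait_excess w w' \<partial>later)"
    unfolding int[OF w(1)] by (rule nn_integral_mono)
  also have "\<dots> = (\<integral>\<^sup>+v. \<Phi> v \<partial>PiM {1..} (wait_laws w')) + C * wait_excess w w'"
  proof -
    have "(\<lambda>X. \<integral>\<^sup>+x. ennreal (wait_density w' x) * \<Psi> x X \<partial>lborel) \<in> borel_measurable later"
    proof (rule lborel.borel_measurable_nn_integral)
      have "(\<lambda>(X, x). \<Psi> x X) \<in> borel_measurable (later \<Otimes>\<^sub>M borel)"
        using measurable_compose[OF measurable_pair_swap' \<Psi>] by (simp add: case_prod_beta')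
      then show "(\<lambda>(X, x). ennreal (wait_density w' x) * \<Psi> x X) \<in> borel_measurable (later \<Otimes>\<^sub>M lborel)"
        by simp
    qed
    then show ?thesis
      unfolding int[OF w(2)] by (subst nn_integral_add) (auto simp: L.emeasure_space_1)
  qed
  finally show ?thesis .
qed

end

section \<open>Comparison of values for different clocks\<close>

text \<open>
  The Doob-Dynkin factorisation: a function measurable with respect to the sigma-algebra generated
  by \<open>f\<close> factors through \<open>f\<close>.
\<close>
lemma vimage_algebra_factor:
  fixes g :: "'a \<Rightarrow> ennreal"
  assumes "g \<in> borel_measurable (vimage_algebra X f N)" and f: "f \<in> X \<rightarrow> space N"
  shows "\<exists>h\<in>borel_measurable N. \<forall>x\<in>X. g x = h (f x)"
  using assms(1)
proof (induction g rule: borel_measurable_induct)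
  case (cong u v)
  then show ?case by auto
next
  case (set A)
  then obtain B where "B \<in> sets N" "A = f -` B \<inter> X"
    by (auto simp: sets_vimage_algebra2[OF f])
  then show ?case by (intro bexI[of _ "indicator B"]) (auto simp: indicator_def)
next
  case (mult u a)
  then obtain h where "h \<in> borel_measurable N" "\<forall>x\<in>X. u x = h (f x)" by blast
  then show ?case by (intro bexI[of _ "\<lambda>y. a * h y"]) auto
next
  case (add u v)
  then obtain h h' where "h \<in> borel_measurable N" "\<forall>x\<in>X. u x = h (f x)"
    "h' \<in> borel_measurable N" "\<forall>x\<in>X. v x = h' (f x)" by blast
  then show ?case by (intro bexI[of _ "\<lambda>y. h' y + h y"]) auto
next
  case (seq V)
  then obtain h where h: "\<And>i. h i \<in> borel_measurable N" "\<And>i x. x \<in> X \<Longrightarrow> V i x = h i (f x)"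
    by metis
  then show ?case by (intro bexI[of _ "\<lambda>y. SUP i. h i y"]) (auto simp: image_comp)
qed

context sparre_andersen
begin

lemma admissible_iff:
  "L \<in> admissible P T p Y U s x \<longleftrightarrow>
     case_prod L \<in> borel_measurable (predictable_algebra (space P) s (aug_history P Y U)) \<and>
     (AE \<omega> in P. admissible_path s T (reserve s x \<omega>) (\<lambda>t. L t \<omega>))"
  unfolding admissible_def admissible_path_def ruin_time_def ruin_at_def wealth_def reserve_def right_lim_def
  by simp

lemma J_fun_eq_payout:
  "J_fun P T p c Y U s x L =
     (\<integral>\<^sup>+\<omega>. payout c s (real_of_ereal (min (ruin_at s (reserve s x \<omega>) (\<lambda>t. L t \<omega>)) (ereal T))) (\<lambda>t. L t \<omega>) \<partial>P)"
  unfolding J_fun_def nn_integral_completion payout_def dividend_measure_def paid_by_def[abs_def]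
    right_lim_def ruin_time_def ruin_at_def wealth_def reserve_def
  by simp

lemma reserve_history:
  assumes "0 \<le> s" "s \<le> t" "t \<le> r"
  shows "(\<lambda>\<omega>. reserve s x \<omega> t) \<in> borel_measurable (history r)"
  unfolding reserve_def using post_total_claim_history[OF assms] by measurable

lemma reserve_post_events:
  assumes "s \<le> t"
  shows "(\<lambda>\<omega>. reserve s x \<omega> t) \<in> borel_measurable (post_events s)"
  unfolding reserve_def using post_total_claim_post_events[OF assms] by measurable

text \<open>
  An upper bound for the reserve on \<open>[s, T]\<close> when claims are nonnegative, and therefore for all
  dividends paid by \<open>T\<close>.
\<close>
definition cap :: "real \<Rightarrow> real" where
  "cap x = x + p * T"

text \<open>
  The event \<open>D r q\<close> plays the part of \<open>{L\<^sub>r > q}\<close>.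
\<close>
definition level_strategy :: "real \<Rightarrow> real \<Rightarrow> (real \<Rightarrow> real \<Rightarrow> 'a set) \<Rightarrow> real \<Rightarrow> 'a \<Rightarrow> real" where
  "level_strategy s x D t \<omega> = staircase s (cap x) (halted s (cap x) (reserve s x \<omega>) (\<lambda>r q. \<omega> \<in> D r q)) t"

text \<open>
  The payoff of the rebuilt strategy.  The levels \<open>a\<close> are not tied to the scenario \<open>\<omega>\<close> that drives
  the reserve, so that they may be read off with a frozen past.
\<close>
definition level_worth :: "real \<Rightarrow> real \<Rightarrow> (real \<Rightarrow> real \<Rightarrow> bool) \<Rightarrow> 'a \<Rightarrow> ennreal" where
  "level_worth s x a \<omega> = discounted_total c s T
     (\<lambda>t. Lim (at_right t) (staircase s (cap x) (halted s (cap x) (reserve s x \<omega>) a)))"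

lemma level_worth_le:
  assumes "s \<le> T" "0 \<le> x"
  shows "level_worth s x a \<omega> \<le> ennreal (cap x)"
  unfolding level_worth_def
proof (rule discounted_total_le)
  let ?l = "staircase s (cap x) (halted s (cap x) (reserve s x \<omega>) a)"
  have C: "0 \<le> cap x" using assms pos by (simp add: cap_def)
  fix t :: real
  have m: "mono_on {t..} ?l" by (rule staircase_mono_on)
  show "0 \<le> Lim (at_right t) ?l \<and> Lim (at_right t) ?l \<le> cap x"
    using mono_right_limit(3)[OF m order_refl] staircase_nonneg[of s "cap x" _ t]
      mono_right_limit(2)[OF m order_refl, of "t + 1"] staircase_le[OF C, of s _ "t + 1"]
    by (meson less_add_one order_trans)
qed (use assms pos in auto)

definition level_family :: "real \<Rightarrow> (real \<Rightarrow> real \<Rightarrow> 'a set) \<Rightarrow> bool" where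
  "level_family s D \<longleftrightarrow> (\<forall>r\<in>\<rat>. \<forall>q\<in>\<rat>. s < r \<longrightarrow> D r q \<in> sets (post_history s r))"

text \<open>
  The measure \<open>P\<close> is arbitrary: the path conditions hold in every scenario and the strategy is
  predictable for the filtration before completion.
\<close>
lemma level_strategy_admissible:
  assumes s: "0 \<le> s" and P: "space P = \<Omega>" and D: "level_family s D"
  shows "level_strategy s x D \<in> admissible P T p Y U s x"
  unfolding admissible_iff
proof
  show "AE \<omega> in P. admissible_path s T (reserve s x \<omega>) (\<lambda>t. level_strategy s x D t \<omega>)"
    unfolding level_strategy_def by (rule AE_I2) (simp add: P halted_admissible reserve_right_continuous)
  have "{\<omega> \<in> \<Omega>. halted s (cap x) (reserve s x \<omega>) (\<lambda>r q. \<omega> \<in> D r q) r q} \<in> sets (aug_history P Y U r)"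
    if "r \<in> \<rat>" "q \<in> \<rat>" "s < r" for r q
  proof -
    have "{\<omega> \<in> space (history r). halted s (cap x) (reserve s x \<omega>) (\<lambda>r q. \<omega> \<in> D r q) r q} \<in> sets (history r)"
    proof (rule halted_sets)
      fix r' q' :: real assume "r' \<in> \<rat>" "q' \<in> \<rat>" "s < r'" "r' < r"
      then have "D r' q' \<in> sets (history r)"
        using D claim_history_mono[of r' r \<Omega> Y U] by (auto simp: level_family_def sets_post_history)
      moreover have "{\<omega> \<in> space (history r). \<omega> \<in> D r' q'} = D r' q'"
        using sets.sets_into_space[OF calculation] by auto
      ultimately show "{\<omega> \<in> space (history r). \<omega> \<in> D r' q'} \<in> sets (history r)" by simp
    next
      fix v assume "s < v" "v < r"
      then show "(\<lambda>\<omega>. reserve s x \<omega> v) \<in> borel_measurable (history r)" using s by (intro reserve_history) auto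
    qed
    then show ?thesis using claim_history_subset_aug[of P Y U r] by (auto simp: P)
  qed
  then show "(\<lambda>(t, \<omega>). level_strategy s x D t \<omega>)
      \<in> borel_measurable (predictable_algebra (space P) s (aug_history P Y U))"
    unfolding level_strategy_def by (intro staircase_predictable) (auto simp: P)
qed

lemma J_level_strategy:
  assumes P: "space P = \<Omega>" and "s \<le> T"
  shows "J_fun P T p c Y U s x (level_strategy s x D) = (\<integral>\<^sup>+\<omega>. level_worth s x (\<lambda>r q. \<omega> \<in> D r q) \<omega> \<partial>P)"
  unfolding J_fun_eq_payout
proof (rule nn_integral_cong)
  fix \<omega> assume "\<omega> \<in> space P"
  then have "admissible_path s T (reserve s x \<omega>) (\<lambda>t. level_strategy s x D t \<omega>)"
    unfolding level_strategy_def by (simp add: P halted_admissible reserve_right_continuous)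
  from payout_admissible[OF this \<open>s \<le> T\<close> pos(3)]
  show "payout c s (real_of_ereal (min (ruin_at s (reserve s x \<omega>) (\<lambda>t. level_strategy s x D t \<omega>)) (ereal T)))
      (\<lambda>t. level_strategy s x D t \<omega>) = level_worth s x (\<lambda>r q. \<omega> \<in> D r q) \<omega>"
    unfolding level_worth_def level_strategy_def .
qed

lemma level_worth_measurable:
  assumes g: "g \<in> N \<rightarrow>\<^sub>M post_events s"
    and a: "\<And>r q. r \<in> \<rat> \<Longrightarrow> q \<in> \<rat> \<Longrightarrow> s < r \<Longrightarrow> {z \<in> space N. a z r q} \<in> sets N"
  shows "(\<lambda>z. level_worth s x (a z) (g z)) \<in> borel_measurable N"
  unfolding level_worth_def
proof (rule discounted_total_staircase_measurable, rule halted_sets)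
  fix v assume "s < v"
  then show "(\<lambda>z. reserve s x (g z) v) \<in> borel_measurable N"
    by (intro measurable_compose[OF g] reserve_post_events) simp
qed (rule a)

end

context conditioned_sparre_andersen
begin

text \<open>
  The payoff is a bounded function of the waiting times and claims after \<open>s\<close>.  After integrating out
  the claims, whose law does not depend on \<open>w\<close>, the comparison is that of the laws of the waiting
  times.
\<close>
lemma level_worth_compare:
  assumes s: "s \<in> {0..T}" and w: "w \<in> {0..s}" "w' \<in> {0..s}" and x: "0 \<le> x" and D: "level_family s D"
  shows "(\<integral>\<^sup>+\<omega>. level_worth s x (\<lambda>r q. \<omega> \<in> D r q) \<omega> \<partial>K s w)
    \<le> (\<integral>\<^sup>+\<omega>. level_worth s x (\<lambda>r q. \<omega> \<in> D r q) \<omega> \<partial>K s w') + ennreal (cap x) * wait_excess w w'"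
proof -
  let ?g = "\<lambda>\<omega>. level_worth s x (\<lambda>r q. \<omega> \<in> D r q) \<omega>" and ?C = "ennreal (cap x)"
  have "?g \<in> borel_measurable (post_events s)"
  proof (rule level_worth_measurable)
    fix r q :: real assume "r \<in> \<rat>" "q \<in> \<rat>" "s < r"
    then have "D r q \<in> sets (post_events s)" using D by (auto simp: level_family_def sets_post_history)
    moreover have "{\<omega> \<in> space (post_events s). \<omega> \<in> D r q} = D r q"
      using sets.sets_into_space[OF calculation] by auto
    ultimately show "{\<omega> \<in> space (post_events s). \<omega> \<in> D r q} \<in> sets (post_events s)" by simp
  qed simp
  moreover have range: "post_data s \<in> \<Omega> \<rightarrow> space data_space"
    by (auto simp: post_data_def space_pair_measure space_PiM)
  ultimately obtain h where h: "h \<in> borel_measurable data_space" "\<And>\<omega>. \<omega> \<in> \<Omega> \<Longrightarrow> ?g \<omega> = h (post_data s \<omega>)"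
    using vimage_algebra_factor[of ?g \<Omega> "post_data s" data_space] unfolding post_events_def by blast
  define \<psi> where "\<psi> z = min (h z) ?C" for z
  have \<psi>[measurable]: "\<psi> \<in> borel_measurable data_space" unfolding \<psi>_def using h(1) by measurable
  have \<psi>_le: "\<psi> z \<le> ?C" for z by (simp add: \<psi>_def)
  have g: "?g \<omega> = \<psi> (post_data s \<omega>)" if "\<omega> \<in> \<Omega>" for \<omega>
    using h(2)[OF that] level_worth_le[of s x "\<lambda>r q. \<omega> \<in> D r q" \<omega>] s x by (simp add: \<psi>_def min_absorb1)
  interpret C: prob_space claims_law by (rule prob_space_claims_law)
  define \<Phi> where "\<Phi> v = (\<integral>\<^sup>+u. \<psi> (v, u) \<partial>claims_law)" for v
  have \<Phi>: "\<Phi> \<in> borel_measurable (PiM {1..} (\<lambda>_. borel))"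
    unfolding \<Phi>_def[abs_def]
  proof (rule C.borel_measurable_nn_integral)
    have "\<psi> \<in> borel_measurable (PiM {1..} (\<lambda>_. borel) \<Otimes>\<^sub>M claims_law)"
      using \<psi> measurable_cong_sets[OF sets_pair_measure_cong[OF refl sets_claims_law] refl] by blast
    then show "(\<lambda>(v, u). \<psi> (v, u)) \<in> borel_measurable (PiM {1..} (\<lambda>_. borel) \<Otimes>\<^sub>M claims_law)" by simp
  qed
  have \<Phi>_le: "\<Phi> v \<le> ?C" for v
  proof -
    have "\<Phi> v \<le> (\<integral>\<^sup>+u. ?C \<partial>claims_law)" unfolding \<Phi>_def by (intro nn_integral_mono \<psi>_le)
    then show ?thesis by (simp add: C.emeasure_space_1)
  qed
  have int: "(\<integral>\<^sup>+\<omega>. ?g \<omega> \<partial>K s u) = (\<integral>\<^sup>+v. \<Phi> v \<partial>PiM {1..} (wait_laws u))" if u: "u \<in> {0..s}" for u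
  proof -
    note sp = prob_space_kernel[OF s u]
    have rv: "post_data s \<in> K s u \<rightarrow>\<^sub>M data_space"
      unfolding post_data_def
      by (intro measurable_Pair measurable_restrict post_wait_random[OF s u] post_claim_random[OF s u]) auto
    have "(\<integral>\<^sup>+\<omega>. ?g \<omega> \<partial>K s u) = (\<integral>\<^sup>+\<omega>. \<psi> (post_data s \<omega>) \<partial>K s u)"
      by (intro nn_integral_cong g) (simp add: sp)
    also have "\<dots> = (\<integral>\<^sup>+z. \<psi> z \<partial>distr (K s u) data_space (post_data s))"
      by (rule nn_integral_distr[symmetric, OF rv]) (use \<psi> in simp)
    also have "\<dots> = (\<integral>\<^sup>+z. \<psi> z \<partial>(PiM {1..} (wait_laws u) \<Otimes>\<^sub>M claims_law))"
      by (simp only: post_data_law[OF s u])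
    also have "\<dots> = (\<integral>\<^sup>+v. \<Phi> v \<partial>PiM {1..} (wait_laws u))"
      unfolding \<Phi>_def
    proof (rule C.nn_integral_fst[symmetric])
      show "\<psi> \<in> borel_measurable (PiM {1..} (wait_laws u) \<Otimes>\<^sub>M claims_law)"
        using \<psi> measurable_cong_sets[OF sets_pair_measure_cong[OF sets_PiM_wait_laws sets_claims_law] refl]
        by blast
    qed
    finally show ?thesis .
  qed
  show ?thesis
    unfolding int[OF w(1)] int[OF w(2)]
    by (rule wait_laws_compare[OF _ _ \<Phi> \<Phi>_le]) (use s w in auto)
qed

lemma claims_nonneg_AE:
  assumes "s \<in> {0..T}" "w \<in> {0..s}"
  shows "AE \<omega> in K s w. \<forall>t. 0 \<le> post_total_claim Y U s t \<omega>"
proof -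
  interpret P: prob_space "K s w" by (rule prob_space_kernel[OF assms])
  have "AE \<omega> in K s w. 0 \<le> post_claim Y U s k \<omega>" if "1 \<le> k" for k
  proof -
    note rv[measurable] = post_claim_random[OF assms that]
    let ?D = "distr (K s w) borel (post_claim Y U s k)"
    interpret D: prob_space ?D by (rule P.prob_space_distr[OF rv])
    have "AE y in ?D. y \<notin> {..- 1 / real (Suc n)}" for n
    proof (rule AE_not_in, rule null_setsI)
      have "measure ?D {..- 1 / real (Suc n)} = 0"
        using fun_cong[OF K_claim[OF assms that], of "- 1 / real (Suc n)"] G_supp[of "- 1 / real (Suc n)"]
        by (simp add: cdf_def)
      then show "emeasure ?D {..- 1 / real (Suc n)} = 0" by (simp add: D.emeasure_eq_measure)
    qed simp
    then have "AE y in ?D. \<forall>n. y \<notin> {..- 1 / real (Suc n)}" by (simp only: AE_all_countable) simp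
    then have "AE y in ?D. 0 \<le> y"
    proof (rule AE_mp, intro AE_I2 impI)
      fix y :: real assume y: "\<forall>n. y \<notin> {..- 1 / real (Suc n)}"
      show "0 \<le> y"
      proof (rule ccontr)
        assume "\<not> 0 \<le> y"
        then obtain n where "1 / real (Suc n) < - y" using nat_approx_posE[of "- y"] by auto
        then have "y \<le> - 1 / real (Suc n)" by simp
        then show False using y by blast
      qed
    qed
    then show ?thesis by (subst (asm) AE_distr_iff) auto
  qed
  then have "AE \<omega> in K s w. \<forall>k\<in>{1..}. 0 \<le> post_claim Y U s k \<omega>" by (subst AE_ball_countable) auto
  then show ?thesis
    by (rule AE_mp) (auto simp: post_total_claim_def intro!: sum_nonneg AE_I2)
qed

text \<open>
  Independence of past and future: the diagonal pair has the same law on their product as two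
  independent copies.
\<close>
lemma nn_integral_history_post:
  assumes s: "s \<in> {0..T}" and w: "w \<in> {0..s}"
    and g[measurable]: "g \<in> borel_measurable (history s \<Otimes>\<^sub>M post_events s)"
  shows "(\<integral>\<^sup>+\<omega>. g (\<omega>, \<omega>) \<partial>K s w) = (\<integral>\<^sup>+\<omega>\<^sub>1. \<integral>\<^sup>+\<omega>\<^sub>2. g (\<omega>\<^sub>1, \<omega>\<^sub>2) \<partial>K s w \<partial>K s w)"
proof -
  let ?P = "K s w"
  interpret P: prob_space ?P by (rule prob_space_kernel[OF s w])
  note sp = prob_space_kernel[OF s w]
  have ind: "P.indep_set (sets (history s)) (sets (post_events s))"
    using K_history_indep[OF s w] by (simp add: post_events_def post_data_def)
  then have sub: "sets (history s) \<subseteq> sets ?P" "sets (post_events s) \<subseteq> sets ?P"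
    unfolding P.indep_sets2_eq by auto
  have H: "(\<lambda>\<omega>. \<omega>) \<in> ?P \<rightarrow>\<^sub>M history s" and E: "(\<lambda>\<omega>. \<omega>) \<in> ?P \<rightarrow>\<^sub>M post_events s"
    using sub by (auto intro!: measurableI simp: sp dest: sets.sets_into_space) 
  have eq: "sigma_sets \<Omega> {(\<lambda>\<omega>. \<omega>) -` A \<inter> \<Omega> |A. A \<in> sets N} = sets N" if "space N = \<Omega>" for N :: "'a measure"
  proof -
    have "{(\<lambda>\<omega>. \<omega>) -` A \<inter> \<Omega> |A. A \<in> sets N} = sets N"
      using sets.sets_into_space[of _ N] that by (auto simp: Int_absorb2)
    then show ?thesis using sets.sigma_sets_eq[of N] that by simp
  qed
  have "P.indep_var (history s) (\<lambda>\<omega>. \<omega>) (post_events s) (\<lambda>\<omega>. \<omega>)"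
    unfolding P.indep_var_eq
  proof (intro conjI H E)
    show "P.indep_set (sigma_sets (space ?P) {(\<lambda>\<omega>. \<omega>) -` A \<inter> space ?P |A. A \<in> sets (history s)})
        (sigma_sets (space ?P) {(\<lambda>\<omega>. \<omega>) -` A \<inter> space ?P |A. A \<in> sets (post_events s)})"
      using ind by (simp only: sp(3) eq[OF space_claim_history] eq[OF space_post_events])
  qed
  then have D: "distr ?P (history s) (\<lambda>\<omega>. \<omega>) \<Otimes>\<^sub>M distr ?P (post_events s) (\<lambda>\<omega>. \<omega>)
      = distr ?P (history s \<Otimes>\<^sub>M post_events s) (\<lambda>\<omega>. (\<omega>, \<omega>))"
    unfolding P.indep_var_distribution_eq by simp
  interpret E: prob_space "distr ?P (post_events s) (\<lambda>\<omega>. \<omega>)" by (rule P.prob_space_distr[OF E])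
  have "(\<integral>\<^sup>+\<omega>. g (\<omega>, \<omega>) \<partial>?P) = (\<integral>\<^sup>+z. g z \<partial>distr ?P (history s \<Otimes>\<^sub>M post_events s) (\<lambda>\<omega>. (\<omega>, \<omega>)))"
    by (rule nn_integral_distr[symmetric]) (use measurable_Pair[OF H E] g in auto)
  also have "\<dots> = (\<integral>\<^sup>+\<omega>\<^sub>1. \<integral>\<^sup>+\<omega>\<^sub>2. g (\<omega>\<^sub>1, \<omega>\<^sub>2) \<partial>distr ?P (post_events s) (\<lambda>\<omega>. \<omega>) \<partial>distr ?P (history s) (\<lambda>\<omega>. \<omega>))"
    unfolding D[symmetric] by (rule E.nn_integral_fst[symmetric]) measurable
  also have "\<dots> = (\<integral>\<^sup>+\<omega>\<^sub>1. \<integral>\<^sup>+\<omega>\<^sub>2. g (\<omega>\<^sub>1, \<omega>\<^sub>2) \<partial>distr ?P (post_events s) (\<lambda>\<omega>. \<omega>) \<partial>?P)"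
    by (rule nn_integral_distr[OF H], rule E.borel_measurable_nn_integral) measurable
  also have "\<dots> = (\<integral>\<^sup>+\<omega>\<^sub>1. \<integral>\<^sup>+\<omega>\<^sub>2. g (\<omega>\<^sub>1, \<omega>\<^sub>2) \<partial>?P \<partial>?P)"
  proof (rule nn_integral_cong)
    fix \<omega>\<^sub>1 assume "\<omega>\<^sub>1 \<in> space ?P"
    then have "\<omega>\<^sub>1 \<in> space (history s)" by (simp add: sp)
    from measurable_compose[OF measurable_Pair1'[OF this] g]
    show "(\<integral>\<^sup>+\<omega>\<^sub>2. g (\<omega>\<^sub>1, \<omega>\<^sub>2) \<partial>distr ?P (post_events s) (\<lambda>\<omega>. \<omega>)) = (\<integral>\<^sup>+\<omega>\<^sub>2. g (\<omega>\<^sub>1, \<omega>\<^sub>2) \<partial>?P)"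
      by (intro nn_integral_distr[OF E]) simp
  qed
  finally show ?thesis .
qed

text \<open>
  The events \<open>{L\<^sub>r > q}\<close> are replaced by raw events that agree with them almost surely, and these
  are split into past and future.  There are countably many pairs \<open>(r, q)\<close>, so outside one null set
  all levels agree, the path of \<open>L\<close> is admissible and the claims are nonnegative.  There the rebuilt
  path has the same payoff, and independence turns the diagonal integral into an iterated one.
\<close>
lemma J_eq_average_level_worth:
  assumes s: "s \<in> {0..T}" and w: "w \<in> {0..s}" and x: "0 \<le> x"
    and L: "L \<in> admissible (K s w) T p Y U s x"
  shows "\<exists>B. (\<forall>\<omega>\<^sub>1\<in>\<Omega>. level_family s (\<lambda>r q. {\<omega>\<^sub>2 \<in> \<Omega>. (\<omega>\<^sub>1, \<omega>\<^sub>2) \<in> B r q})) \<and>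
    J_fun (K s w) T p c Y U s x L =
      (\<integral>\<^sup>+\<omega>\<^sub>1. \<integral>\<^sup>+\<omega>\<^sub>2. level_worth s x (\<lambda>r q. (\<omega>\<^sub>1, \<omega>\<^sub>2) \<in> B r q) \<omega>\<^sub>2 \<partial>K s w \<partial>K s w)"
proof -
  let ?P = "K s w"
  note sp = prob_space_kernel[OF s w]
  have s0: "0 \<le> s" "s \<le> T" using s by auto
  have C: "0 \<le> cap x" using x pos by (simp add: cap_def)
  have ex: "\<exists>B. B \<in> sets (history s \<Otimes>\<^sub>M post_history s r) \<and> (AE \<omega> in ?P. q < L r \<omega> \<longleftrightarrow> (\<omega>, \<omega>) \<in> B)"
    if "s < r" for r q
  proof -
    have sr: "s \<le> r" using that by simp
    have "L r \<in> borel_measurable (aug_history ?P Y U r)"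
      by (rule predictable_adapted[where \<Omega>="space ?P" and s=s])
        (use L that in \<open>auto simp: admissible_iff dest: aug_history_mono[THEN subsetD]\<close>)
    then have "{\<omega> \<in> space (aug_history ?P Y U r). q < L r \<omega>} \<in> sets (aug_history ?P Y U r)" by measurable
    from aug_history_approx[OF this] obtain A where A: "A \<in> sets (history r)"
      "AE \<omega> in ?P. (\<omega> \<in> space ?P \<and> q < L r \<omega>) \<longleftrightarrow> \<omega> \<in> A" by (auto simp: sp)
    from history_split[OF s0(1) sr A(1)] obtain B where
      B: "B \<in> sets (history s \<Otimes>\<^sub>M post_history s r)" "\<forall>\<omega>\<in>\<Omega>. \<omega> \<in> A \<longleftrightarrow> (\<omega>, \<omega>) \<in> B" by blast
    have "AE \<omega> in ?P. q < L r \<omega> \<longleftrightarrow> (\<omega>, \<omega>) \<in> B"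
      using A(2) AE_space by eventually_elim (use B(2) in \<open>simp add: sp\<close>)
    then show ?thesis using B(1) by blast
  qed
  define B where "B r q = (SOME B. B \<in> sets (history s \<Otimes>\<^sub>M post_history s r) \<and>
      (AE \<omega> in ?P. q < L r \<omega> \<longleftrightarrow> (\<omega>, \<omega>) \<in> B))" for r q
  have ok: "B r q \<in> sets (history s \<Otimes>\<^sub>M post_history s r) \<and>
      (AE \<omega> in ?P. q < L r \<omega> \<longleftrightarrow> (\<omega>, \<omega>) \<in> B r q)" if "s < r" for r q
    unfolding B_def by (rule someI_ex, rule ex[OF that])
  note B = conjunct1[OF ok] conjunct2[OF ok]
  let ?g = "\<lambda>z. level_worth s x (\<lambda>r q. z \<in> B r q) (snd z)"
  have "AE \<omega> in ?P. \<forall>r\<in>\<rat> \<inter> {s<..}. \<forall>q\<in>\<rat>. q < L r \<omega> \<longleftrightarrow> (\<omega>, \<omega>) \<in> B r q"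
    by (subst AE_ball_countable, simp add: countable_rat, intro ballI, subst AE_ball_countable[OF countable_rat])
      (use B(2) in auto)
  moreover have "AE \<omega> in ?P. admissible_path s T (reserve s x \<omega>) (\<lambda>t. L t \<omega>)"
    using L by (simp add: admissible_iff)
  ultimately have "AE \<omega> in ?P. payout c s (real_of_ereal (min (ruin_at s (reserve s x \<omega>) (\<lambda>t. L t \<omega>)) (ereal T)))
      (\<lambda>t. L t \<omega>) = ?g (\<omega>, \<omega>)"
    using claims_nonneg_AE[OF s w]
  proof eventually_elim
    case (elim \<omega>)
    have "discounted_total c s T (\<lambda>t. Lim (at_right t) (\<lambda>t. L t \<omega>)) = ?g (\<omega>, \<omega>)"
    proof -
      have "Lim (at_right t) (staircase s (cap x) (halted s (cap x) (reserve s x \<omega>) (\<lambda>r q. (\<omega>, \<omega>) \<in> B r q)))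
          = Lim (at_right t) (\<lambda>t. L t \<omega>)" if "s \<le> t" "t \<le> T" for t
      proof (rule halted_right_limit[OF elim(2) C])
        show "reserve s x \<omega> u \<le> cap x" if "s \<le> u" "u \<le> T" for u
        proof -
          have "p * (u - s) \<le> p * T" using pos s0 that by (intro mult_left_mono) auto
          then show ?thesis using elim(3)[rule_format, of u] by (simp add: reserve_def cap_def)
        qed
      qed (use elim(1) that in auto)
      then show ?thesis
        unfolding level_worth_def discounted_total_def using s0
        by (intro arg_cong2[where f="(+)"] nn_integral_cong) (auto simp: indicator_def)
    qed
    then show ?case using payout_admissible[OF elim(2) s0(2) pos(3)] by simp
  qed
  then have "J_fun ?P T p c Y U s x L = (\<integral>\<^sup>+\<omega>. ?g (\<omega>, \<omega>) \<partial>?P)"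
    unfolding J_fun_eq_payout by (rule nn_integral_cong_AE)
  also have "\<dots> = (\<integral>\<^sup>+\<omega>\<^sub>1. \<integral>\<^sup>+\<omega>\<^sub>2. ?g (\<omega>\<^sub>1, \<omega>\<^sub>2) \<partial>?P \<partial>?P)"
  proof (rule nn_integral_history_post[OF s w], rule level_worth_measurable)
    fix r q :: real assume r: "r \<in> \<rat>" "q \<in> \<rat>" "s < r"
    have "(\<lambda>\<omega>. \<omega>) \<in> post_events s \<rightarrow>\<^sub>M post_history s r"
      by (rule measurableI) (auto simp: sets_post_history Int_absorb2 dest: sets.sets_into_space)
    then have "(\<lambda>z. (fst z, snd z)) \<in> history s \<Otimes>\<^sub>M post_events s \<rightarrow>\<^sub>M history s \<Otimes>\<^sub>M post_history s r"
      by (intro measurable_Pair measurable_compose[OF measurable_snd]) auto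
    from measurable_sets[OF this B(1)[OF r(3), of q]]
    have "(\<lambda>z. (fst z, snd z)) -` B r q \<inter> space (history s \<Otimes>\<^sub>M post_events s)
        \<in> sets (history s \<Otimes>\<^sub>M post_events s)" .
    moreover have "(\<lambda>z. (fst z, snd z)) -` B r q \<inter> space (history s \<Otimes>\<^sub>M post_events s)
        = {z \<in> space (history s \<Otimes>\<^sub>M post_events s). z \<in> B r q}"
      unfolding prod.collapse by blast
    ultimately show "{z \<in> space (history s \<Otimes>\<^sub>M post_events s). z \<in> B r q} \<in> sets (history s \<Otimes>\<^sub>M post_events s)"
      by (simp only:)
  qed simp
  finally have J: "J_fun ?P T p c Y U s x L =
      (\<integral>\<^sup>+\<omega>\<^sub>1. \<integral>\<^sup>+\<omega>\<^sub>2. level_worth s x (\<lambda>r q. (\<omega>\<^sub>1, \<omega>\<^sub>2) \<in> B r q) \<omega>\<^sub>2 \<partial>?P \<partial>?P)" by simp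
  have "level_family s (\<lambda>r q. {\<omega>\<^sub>2 \<in> \<Omega>. (\<omega>\<^sub>1, \<omega>\<^sub>2) \<in> B r q})" if "\<omega>\<^sub>1 \<in> \<Omega>" for \<omega>\<^sub>1
    unfolding level_family_def
  proof (intro ballI impI)
    fix r q :: real assume r: "s < r"
    have "Pair \<omega>\<^sub>1 -` B r q \<in> sets (post_history s r)"
      by (rule sets_Pair1[OF B(1)[OF r]])
    moreover have "{\<omega>\<^sub>2 \<in> \<Omega>. (\<omega>\<^sub>1, \<omega>\<^sub>2) \<in> B r q} = Pair \<omega>\<^sub>1 -` B r q"
      using sets.sets_into_space[OF calculation] by auto
    ultimately show "{\<omega>\<^sub>2 \<in> \<Omega>. (\<omega>\<^sub>1, \<omega>\<^sub>2) \<in> B r q} \<in> sets (post_history s r)" by simp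
  qed
  with J show ?thesis by (intro exI[of _ B] conjI ballI)
qed

lemma value_fun_nonneg:
  assumes "s \<in> {0..T}" "w \<in> {0..s}"
  shows "0 \<le> value_fun K T p c Y U s x w"
proof -
  have "level_strategy s x (\<lambda>_ _. {}) \<in> admissible (K s w) T p Y U s x"
    by (rule level_strategy_admissible) (use assms prob_space_kernel[OF assms] in \<open>auto simp: level_family_def\<close>)
  then show ?thesis
    unfolding value_fun_def by (rule SUP_upper2) simp
qed

lemma value_fun_le:
  assumes s: "s \<in> {0..T}" and w: "w \<in> {0..s}" and x: "0 \<le> x"
  shows "value_fun K T p c Y U s x w \<le> ereal (cap x)"
  unfolding value_fun_def
proof (rule SUP_least)
  interpret P: prob_space "K s w" by (rule prob_space_kernel[OF s w])
  fix L assume "L \<in> admissible (K s w) T p Y U s x"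
  from J_eq_average_level_worth[OF s w x this] obtain B where
    "J_fun (K s w) T p c Y U s x L =
      (\<integral>\<^sup>+\<omega>\<^sub>1. \<integral>\<^sup>+\<omega>\<^sub>2. level_worth s x (\<lambda>r q. (\<omega>\<^sub>1, \<omega>\<^sub>2) \<in> B r q) \<omega>\<^sub>2 \<partial>K s w \<partial>K s w)"
    by (elim exE conjE) (rule that)
  also have "\<dots> \<le> (\<integral>\<^sup>+\<omega>\<^sub>1. \<integral>\<^sup>+\<omega>\<^sub>2. ennreal (cap x) \<partial>K s w \<partial>K s w)"
    using s x by (intro nn_integral_mono level_worth_le) auto
  finally have "J_fun (K s w) T p c Y U s x L \<le> ennreal (cap x)" by (simp add: P.emeasure_space_1)
  then have "enn2ereal (J_fun (K s w) T p c Y U s x L) \<le> enn2ereal (ennreal (cap x))" by (simp add: less_eq_ennreal.rep_eq)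
  moreover have "0 \<le> cap x" using x pos by (simp add: cap_def)
  ultimately show "enn2ereal (J_fun (K s w) T p c Y U s x L) \<le> ereal (cap x)" by (simp add: enn2ereal_ennreal)
qed

text \<open>
  For each frozen past \<open>\<omega>\<^sub>1\<close> the rebuilt strategy is a competitor for \<open>w'\<close>, and its values for \<open>w\<close> and
  \<open>w'\<close> differ by at most \<open>e\<close>.  Averaging over \<open>\<omega>\<^sub>1\<close> bounds the value of the original strategy.
\<close>
lemma value_fun_compare:
  assumes s: "s \<in> {0..T}" and w: "w \<in> {0..s}" "w' \<in> {0..s}" and x: "0 \<le> x"
    and e: "ennreal (cap x) * wait_excess w w' \<le> ennreal e" "0 \<le> e"
  shows "value_fun K T p c Y U s x w \<le> value_fun K T p c Y U s x w' + ereal e"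
proof (subst value_fun_def, rule SUP_least)
  let ?V' = "value_fun K T p c Y U s x w'"
  interpret P: prob_space "K s w" by (rule prob_space_kernel[OF s w(1)])
  note sp = prob_space_kernel[OF s w(1)] and sp' = prob_space_kernel[OF s w(2)]
  fix L assume "L \<in> admissible (K s w) T p Y U s x"
  from J_eq_average_level_worth[OF s w(1) x this] obtain B where
    D: "\<forall>\<omega>\<^sub>1\<in>\<Omega>. level_family s (\<lambda>r q. {\<omega>\<^sub>2 \<in> \<Omega>. (\<omega>\<^sub>1, \<omega>\<^sub>2) \<in> B r q})" and
    J: "J_fun (K s w) T p c Y U s x L =
      (\<integral>\<^sup>+\<omega>\<^sub>1. \<integral>\<^sup>+\<omega>\<^sub>2. level_worth s x (\<lambda>r q. (\<omega>\<^sub>1, \<omega>\<^sub>2) \<in> B r q) \<omega>\<^sub>2 \<partial>K s w \<partial>K s w)"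
    by (elim exE conjE) (rule that)
  have "(\<integral>\<^sup>+\<omega>\<^sub>2. level_worth s x (\<lambda>r q. (\<omega>\<^sub>1, \<omega>\<^sub>2) \<in> B r q) \<omega>\<^sub>2 \<partial>K s w) \<le> e2ennreal ?V' + ennreal e"
    if "\<omega>\<^sub>1 \<in> \<Omega>" for \<omega>\<^sub>1
  proof -
    define D where "D r q = {\<omega>\<^sub>2 \<in> \<Omega>. (\<omega>\<^sub>1, \<omega>\<^sub>2) \<in> B r q}" for r q
    have fam: "level_family s D" using bspec[OF D that] unfolding D_def[abs_def] .
    have "(\<integral>\<^sup>+\<omega>\<^sub>2. level_worth s x (\<lambda>r q. (\<omega>\<^sub>1, \<omega>\<^sub>2) \<in> B r q) \<omega>\<^sub>2 \<partial>K s w)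
        = (\<integral>\<^sup>+\<omega>. level_worth s x (\<lambda>r q. \<omega> \<in> D r q) \<omega> \<partial>K s w)"
      by (intro nn_integral_cong) (simp add: D_def sp)
    also have "\<dots> \<le> (\<integral>\<^sup>+\<omega>. level_worth s x (\<lambda>r q. \<omega> \<in> D r q) \<omega> \<partial>K s w') + ennreal (cap x) * wait_excess w w'"
      by (rule level_worth_compare[OF s w x fam])
    also have "\<dots> \<le> J_fun (K s w') T p c Y U s x (level_strategy s x D) + ennreal e"
      using e(1) s by (subst J_level_strategy) (auto simp: sp' intro: add_left_mono)
    also have "\<dots> \<le> e2ennreal ?V' + ennreal e"
    proof (rule add_right_mono)
      have "level_strategy s x D \<in> admissible (K s w') T p Y U s x"
        by (rule level_strategy_admissible[OF _ _ fam]) (use s sp' in auto)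
      then have "enn2ereal (J_fun (K s w') T p c Y U s x (level_strategy s x D)) \<le> ?V'"
        unfolding value_fun_def by (rule SUP_upper)
      from e2ennreal_mono[OF this]
      show "J_fun (K s w') T p c Y U s x (level_strategy s x D) \<le> e2ennreal ?V'" by simp
    qed
    finally show ?thesis .
  qed
  then have "J_fun (K s w) T p c Y U s x L \<le> (\<integral>\<^sup>+\<omega>\<^sub>1. e2ennreal ?V' + ennreal e \<partial>K s w)"
    unfolding J by (intro nn_integral_mono) (simp add: sp)
  then have "J_fun (K s w) T p c Y U s x L \<le> e2ennreal ?V' + ennreal e" by (simp add: P.emeasure_space_1)
  then have "enn2ereal (J_fun (K s w) T p c Y U s x L) \<le> enn2ereal (e2ennreal ?V' + ennreal e)"
    by (simp add: less_eq_ennreal.rep_eq)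
  then show "enn2ereal (J_fun (K s w) T p c Y U s x L) \<le> ?V' + ereal e"
    using value_fun_nonneg[OF s w(2)] e(2) by (simp add: plus_ennreal.rep_eq enn2ereal_e2ennreal enn2ereal_ennreal)
qed

text \<open>
  Only the bound \<open>cap x\<close> on payoffs involves \<open>x\<close>, and it is monotone in \<open>x\<close>, so one modulus serves
  all \<open>x \<le> X\<close> and all \<open>s\<close>.
\<close>
lemma value_fun_clock_uniform:
  assumes "0 \<le> X" "0 < \<epsilon>"
  shows "\<exists>\<delta>>0. \<forall>s\<in>{0..T}. \<forall>x\<in>{0..X}. \<forall>w\<in>{0..s}. \<forall>w'\<in>{0..s}. \<bar>w - w'\<bar> < \<delta> \<longrightarrow>
    \<bar>value_fun K T p c Y U s x w - value_fun K T p c Y U s x w'\<bar> < ereal \<epsilon>"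
proof -
  have C: "0 < cap X" using assms pos by (simp add: cap_def add_nonneg_pos)
  define \<eta> where "\<eta> = \<epsilon> / (2 * cap X)"
  have "0 < \<eta>" using C assms by (simp add: \<eta>_def)
  from wait_excess_small[OF this] obtain \<delta> where \<delta>: "0 < \<delta>"
    "\<And>w w'. w \<in> {0..T} \<Longrightarrow> w' \<in> {0..T} \<Longrightarrow> \<bar>w - w'\<bar> < \<delta> \<Longrightarrow> wait_excess w w' \<le> ennreal \<eta>" by blast
  show ?thesis
  proof (intro exI[of _ \<delta>] conjI ballI impI \<delta>(1))
    fix s x w w' assume s: "s \<in> {0..T}" and x: "x \<in> {0..X}" and w: "w \<in> {0..s}" "w' \<in> {0..s}" "\<bar>w - w'\<bar> < \<delta>"
    have x0: "0 \<le> x" using x by simp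
    have excess: "ennreal (cap x) * wait_excess u u' \<le> ennreal (\<epsilon> / 2)"
      if "u \<in> {0..s}" "u' \<in> {0..s}" "\<bar>u - u'\<bar> < \<delta>" for u u'
    proof -
      have "wait_excess u u' \<le> ennreal \<eta>" using that s by (intro \<delta>(2)) auto
      moreover have "ennreal (cap x) \<le> ennreal (cap X)" using x by (intro ennreal_leI) (simp add: cap_def)
      ultimately have "ennreal (cap x) * wait_excess u u' \<le> ennreal (cap X) * ennreal \<eta>" by (intro mult_mono) auto
      also have "\<dots> = ennreal (\<epsilon> / 2)" using C \<open>0 < \<eta>\<close> by (simp add: ennreal_mult[symmetric] \<eta>_def)
      finally show ?thesis .
    qed
    have e: "0 \<le> \<epsilon> / 2" using assms by simp
    have 1: "value_fun K T p c Y U s x w \<le> value_fun K T p c Y U s x w' + ereal (\<epsilon> / 2)"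
      by (rule value_fun_compare[OF s w(1,2) x0 excess[OF w] e])
    have 2: "value_fun K T p c Y U s x w' \<le> value_fun K T p c Y U s x w + ereal (\<epsilon> / 2)"
      by (rule value_fun_compare[OF s w(2,1) x0 excess[OF w(2,1)] e]) (use w(3) in auto)
    show "\<bar>value_fun K T p c Y U s x w - value_fun K T p c Y U s x w'\<bar> < ereal \<epsilon>"
      using 1 2 value_fun_nonneg[OF s w(1), of x] value_fun_nonneg[OF s w(2), of x]
        value_fun_le[OF s w(1) x0] value_fun_le[OF s w(2) x0] assms(2)
      by (cases "value_fun K T p c Y U s x w"; cases "value_fun K T p c Y U s x w'") auto
  qed
qed

end

theorem proposition3p5:
  fixes M :: "'a measure"
    and T p c :: real
    and F f lam G :: "real \<Rightarrow> real"
    and Y U :: "nat \<Rightarrow> 'a \<Rightarrow> real"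
    and K :: "real \<Rightarrow> real \<Rightarrow> 'a measure"
    and \<DD> :: "(real \<times> real \<times> real) set"
  assumes model: "conditioned_sparre_andersen M T p c F f lam G Y U K"
    and "compact \<DD>"
    and "\<DD> \<subseteq> state_domain T"
  shows "\<forall>\<epsilon>>0. \<exists>\<delta>>0. \<forall>s x w h.
           0 < h \<and> h < \<delta> \<and> (s, x, w) \<in> \<DD> \<and> (s, x, w + h) \<in> \<DD> \<longrightarrow>
             \<bar>value_fun K T p c Y U s x w - value_fun K T p c Y U s x (w + h)\<bar> < ereal \<epsilon>"
proof (intro allI impI)
  interpret conditioned_sparre_andersen M T p c F f lam G Y U K by (rule model)
  obtain X where X: "\<And>z. z \<in> \<DD> \<Longrightarrow> norm z \<le> X" "0 < X"
    using compact_imp_bounded[OF \<open>compact \<DD>\<close>] unfolding bounded_pos by blast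
  have x_le: "x \<le> X" if "(s, x, w) \<in> \<DD>" for s x w
  proof -
    have "norm x \<le> norm (s, x, w)"
      using norm_snd_le[of "(x, w)" s] norm_fst_le[of x w] by linarith
    then show ?thesis using X(1)[OF that] by simp
  qed
  fix \<epsilon> :: real assume "0 < \<epsilon>"
  from value_fun_clock_uniform[OF _ this, of X] X(2) obtain \<delta> where \<delta>: "0 < \<delta>"
    "\<And>s x w w'. s \<in> {0..T} \<Longrightarrow> x \<in> {0..X} \<Longrightarrow> w \<in> {0..s} \<Longrightarrow> w' \<in> {0..s} \<Longrightarrow> \<bar>w - w'\<bar> < \<delta> \<Longrightarrow>
      \<bar>value_fun K T p c Y U s x w - value_fun K T p c Y U s x w'\<bar> < ereal \<epsilon>" by auto
  show "\<exists>\<delta>>0. \<forall>s x w h. 0 < h \<and> h < \<delta> \<and> (s, x, w) \<in> \<DD> \<and> (s, x, w + h) \<in> \<DD> \<longrightarrow>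
      \<bar>value_fun K T p c Y U s x w - value_fun K T p c Y U s x (w + h)\<bar> < ereal \<epsilon>"
  proof (intro exI[of _ \<delta>] conjI allI impI \<delta>(1))
    fix s x w h assume h: "0 < h \<and> h < \<delta> \<and> (s, x, w) \<in> \<DD> \<and> (s, x, w + h) \<in> \<DD>"
    then have "(s, x, w) \<in> state_domain T" "(s, x, w + h) \<in> state_domain T" "x \<le> X"
      using \<open>\<DD> \<subseteq> state_domain T\<close> x_le by blast+
    then show "\<bar>value_fun K T p c Y U s x w - value_fun K T p c Y U s x (w + h)\<bar> < ereal \<epsilon>"
      using h by (intro \<delta>(2)) (auto simp: state_domain_def)
  qed
qed

end
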